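(* Let $\mathcal{X}$ be a nonempty Polish space, $\mathcal{Y}=\mathbb{R}^d$, $p>1$, let $\nu\in\mathcal{P}_p(\mathcal{Y})$ satisfy $\nu\ll\mathcal{L}^d$, and let $\rho:\mathcal{X}\to\mathcal{P}(\mathcal{Y})$ be a Markov kernel. Let $\mathscr{A}\subseteq\mathcal{P}(\mathcal{X})$ be the set of minimizers of $\sigma\mapsto W_p^p(\nu_\sigma,\nu)$ over $\mathcal{P}(\mathcal{X})$. Then minimizers are unique (i.e. any two elements of $\mathscr{A}$ coincide) if and only if both of the following hold: (INJ) the map $\sigma\mapsto\nu_\sigma$ is injective on $\mathscr{A}$; and (feasibility) $\inf_{\sigma\in\mathcal{P}(\mathcal{X})}W_p^p(\nu_\sigma,\nu)<+\infty$.
   Context: $\mathcal{P}(\cdot)$ denotes Borel probability measures; $\mathcal{L}^d$ is Lebesgue measure on $\mathbb{R}^d$; $M_p(\mu)=\int|y|^p\,d\mu(y)$ and $\mathcal{P}_p(\mathcal{Y})=\{\mu\in\mathcal{P}(\mathcal{Y}):M_p(\mu)<\infty\}$. A Markov kernel $\rho:\mathcal{X}\to\mathcal{P}(\mathcal{Y})$, $x\mapsto\rho_x$, is a map such that $x\mapsto\rho_x(B)$ is Borel measurable for every Borel $B\subseteq\mathcal{Y}$. For $\sigma\in\mathcal{P}(\mathcal{X})$, $\nu_\sigma\in\mathcal{P}(\mathcal{Y})$ is defined by $\int f\,d\nu_\sigma=\int_{\mathcal{X}}\left(\int_{\mathcal{Y}}f(y)\,d\rho_x(y)\right)d\sigma(x)$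 for all $f\in C_b(\mathcal{Y})$. $W_p^p(\mu_1,\mu_2)=\inf_\Gamma\int|y'-y|^p\,d\Gamma(y',y)\in[0,\infty]$, the infimum over couplings of $\mu_1,\mu_2$. A minimizer is any $\sigma_*\in\mathcal{P}(\mathcal{X})$ with $W_p^p(\nu_{\sigma_*},\nu)=\inf_\sigma W_p^p(\nu_\sigma,\nu)$, also when the infimum is $+\infty$.
   Formalization: Added hypothesis: if X is a single point x, then ρ_x has finite p-th moment; without it (e.g. ρ_x Cauchy, ν uniform on [0,1]) the only measure is trivially the unique minimizer and (INJ) holds, but the infimum is +∞. *)

theory Defs
  imports "HOL-Probability.Probability"
begin

definition borel_probs :: "'a::topological_space measure set" where
  "borel_probs = {M. sets M = sets borel \<and> prob_space M}"

definition p_moment :: "real \<Rightarrow> 'b::euclidean_space measure \<Rightarrow> ennreal" where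
  "p_moment p M = (\<integral>\<^sup>+ y. ennreal (norm y powr p) \<partial>M)"

definition borel_probs_p :: "real \<Rightarrow> 'b::euclidean_space measure set" where
  "borel_probs_p p = {M \<in> borel_probs. p_moment p M < \<infinity>}"

definition markov_kernel ::
    "('a::topological_space \<Rightarrow> 'b::topological_space measure) \<Rightarrow> bool" where
  "markov_kernel \<rho> \<longleftrightarrow>
     (\<forall>x. \<rho> x \<in> borel_probs) \<and>
     (\<forall>B \<in> sets borel. (\<lambda>x. emeasure (\<rho> x) B) \<in> borel_measurable borel)"

(* For a kernel and a probability measure, the monadic bind is the unique Borel probability
   measure that satisfies the integral identity for all bounded continuous f;
   see mixture_unique below. *)
definition mixture ::
    "('a::topological_space \<Rightarrow> 'b::topological_space measure) \<Rightarrow> 'a measure \<Rightarrow> 'b measure" where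
  "mixture \<rho> \<sigma> = \<sigma> \<bind> \<rho>"

definition couplings ::
    "'b::topological_space measure \<Rightarrow> 'b measure \<Rightarrow> ('b \<times> 'b) measure set" where
  "couplings \<mu>1 \<mu>2 = {\<Gamma> \<in> borel_probs. distr \<Gamma> borel fst = \<mu>1 \<and> distr \<Gamma> borel snd = \<mu>2}"

(* The p-th power of the Wasserstein distance. *)
definition wasserstein_pow ::
    "real \<Rightarrow> 'b::euclidean_space measure \<Rightarrow> 'b measure \<Rightarrow> ennreal" where
  "wasserstein_pow p \<mu>1 \<mu>2 =
     (INF \<Gamma> \<in> couplings \<mu>1 \<mu>2. \<integral>\<^sup>+ z. ennreal (norm (fst z - snd z) powr p) \<partial>\<Gamma>)"

definition min_value ::
    "real \<Rightarrow> ('a::topological_space \<Rightarrow> 'b::euclidean_space measure) \<Rightarrow> 'b measure \<Rightarrow> ennreal" where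
  "min_value p \<rho> \<nu> = (INF \<sigma> \<in> borel_probs. wasserstein_pow p (mixture \<rho> \<sigma>) \<nu>)"

definition minimizers ::
    "real \<Rightarrow> ('a::topological_space \<Rightarrow> 'b::euclidean_space measure) \<Rightarrow> 'b measure \<Rightarrow> 'a measure set" where
  "minimizers p \<rho> \<nu> =
     {\<sigma> \<in> borel_probs. wasserstein_pow p (mixture \<rho> \<sigma>) \<nu> = min_value p \<rho> \<nu>}"

lemma markov_kernel_iff: "markov_kernel \<rho> \<longleftrightarrow> \<rho> \<in> borel \<rightarrow>\<^sub>M prob_algebra borel"
proof
  assume k: "markov_kernel \<rho>"
  show "\<rho> \<in> borel \<rightarrow>\<^sub>M prob_algebra borel"
  proof (rule measurable_prob_algebraI)
    show "\<rho> \<in> borel \<rightarrow>\<^sub>M subprob_algebra borel"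
      using k by (intro measurable_subprob_algebra)
        (auto simp: markov_kernel_def borel_probs_def intro: prob_space_imp_subprob_space)
  qed (use k in \<open>auto simp: markov_kernel_def borel_probs_def\<close>)
next
  assume m: "\<rho> \<in> borel \<rightarrow>\<^sub>M prob_algebra borel"
  have "\<rho> x \<in> borel_probs" for x
    using measurable_space[OF m, of x] by (auto simp: space_prob_algebra borel_probs_def)
  moreover have "(\<lambda>x. emeasure (\<rho> x) B) \<in> borel_measurable borel" if "B \<in> sets borel" for B
    using measurable_emeasure_kernel[OF measurable_prob_algebraD[OF m] that] .
  ultimately show "markov_kernel \<rho>" by (auto simp: markov_kernel_def)
qed

lemma mixture_in_borel_probs:
  assumes "markov_kernel \<rho>" "\<sigma> \<in> borel_probs"
  shows "mixture \<rho> \<sigma> \<in> borel_probs"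
proof -
  have s: "sets \<sigma> = sets borel" "prob_space \<sigma>" using assms(2) by (auto simp: borel_probs_def)
  have m: "\<rho> \<in> \<sigma> \<rightarrow>\<^sub>M prob_algebra borel"
    using assms(1) s by (simp add: markov_kernel_iff cong: measurable_cong_sets)
  have "\<sigma> \<in> space (prob_algebra \<sigma>)" using s by (simp add: space_prob_algebra)
  then have "sets (\<sigma> \<bind> \<rho>) = sets borel"
    using measurable_prob_algebraD[OF m] s prob_space.not_empty
    by (intro sets_bind) (auto dest: sets_kernel)
  moreover have "prob_space (\<sigma> \<bind> \<rho>)"
    using assms(1) measurable_prob_algebraD[OF m]
    by (intro prob_space.prob_space_bind[OF s(2)]) (auto simp: markov_kernel_def borel_probs_def)
  ultimately show ?thesis by (simp add: borel_probs_def mixture_def)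
qed

lemma integral_mixture:
  fixes f :: "'b::topological_space \<Rightarrow> real"
  assumes "markov_kernel \<rho>" "\<sigma> \<in> borel_probs" "continuous_on UNIV f" "bounded (range f)"
  shows "(\<integral>y. f y \<partial>mixture \<rho> \<sigma>) = (\<integral>x. (\<integral>y. f y \<partial>\<rho> x) \<partial>\<sigma>)"
proof -
  have s: "sets \<sigma> = sets borel" "prob_space \<sigma>" using assms(2) by (auto simp: borel_probs_def)
  have m: "\<rho> \<in> \<sigma> \<rightarrow>\<^sub>M prob_algebra borel"
    using assms(1) s by (simp add: markov_kernel_iff cong: measurable_cong_sets)
  obtain B where B: "\<And>y. \<bar>f y\<bar> \<le> B" using assms(4) by (auto simp: bounded_iff)
  show ?thesis unfolding mixture_def
  proof (rule integral_bind[where K = borel and B' = 1 and B = B])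
    show "f \<in> borel_measurable borel" using assms(3) by (rule borel_measurable_continuous_onI)
    show "\<rho> \<in> \<sigma> \<rightarrow>\<^sub>M subprob_algebra borel" using m by (rule measurable_prob_algebraD)
    show "finite_measure \<sigma>" using s(2) by (rule prob_space.finite_measure)
    show "AE x in \<sigma>. emeasure (\<rho> x) (space (\<rho> x)) \<le> ennreal 1"
      using assms(1)
      by (auto simp: markov_kernel_def borel_probs_def prob_space.emeasure_space_1 intro!: AE_I2)
  qed (use B in auto)
qed

lemma borel_probs_eqI:
  fixes M N :: "'b::metric_space measure"
  assumes "M \<in> borel_probs" "N \<in> borel_probs"
    and eq: "\<And>f :: 'b \<Rightarrow> real. continuous_on UNIV f \<Longrightarrow> bounded (range f) \<Longrightarrow>
               integral\<^sup>L M f = integral\<^sup>L N f"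
  shows "M = N"
proof -
  have op: "measure M U = measure N U" if "open U" "U \<noteq> UNIV" for U
  proof -
    define s where "s n x = min 1 (real n * infdist x (- U))" for n x
    have lim: "(\<lambda>n. s n x) \<longlonglongrightarrow> indicator U x" for x
    proof (cases "x \<in> U")
      case True
      then have pos: "infdist x (- U) > 0"
        using that in_closed_iff_infdist_zero[of "- U" x] infdist_nonneg[of x "- U"]
        by (auto simp: closed_Compl less_le)
      obtain k :: nat where k: "1 < real k * infdist x (- U)"
        using reals_Archimedean3[OF pos, rule_format, of 1] by blast
      have "s n x = 1" if "n \<ge> k" for n
      proof -
        have "real k * infdist x (- U) \<le> real n * infdist x (- U)"
          using that by (intro mult_right_mono infdist_nonneg) simp
        then show ?thesis using k by (simp add: s_def)
      qed
      then show ?thesis using True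
        by (intro tendsto_eventually) (auto simp: eventually_sequentially)
    next
      case False
      then show ?thesis by (simp add: s_def)
    qed
    have cont: "continuous_on UNIV (s n)" for n unfolding s_def by (intro continuous_intros)
    have bd: "norm (s n x) \<le> 1" for n x by (auto simp: s_def infdist_nonneg)
    have *: "(\<lambda>n. integral\<^sup>L K (s n)) \<longlonglongrightarrow> measure K U" if K: "K \<in> borel_probs" for K
    proof -
      interpret prob_space K using K by (simp add: borel_probs_def)
      have K': "sets K = sets borel" using K by (simp add: borel_probs_def)
      have "(\<lambda>n. integral\<^sup>L K (s n)) \<longlonglongrightarrow> integral\<^sup>L K (indicator U)"
      proof (rule integral_dominated_convergence[where w = "\<lambda>_. 1"])
        show "s n \<in> borel_measurable K" for n
          using borel_measurable_continuous_onI[OF cont] K' by (simp cong: measurable_cong_sets)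
        show "(indicator U :: 'b \<Rightarrow> real) \<in> borel_measurable K"
          using \<open>open U\<close> K' by (simp cong: measurable_cong_sets)
      qed (use lim bd in auto)
      then show ?thesis using K' sets_eq_imp_space_eq[OF K'] by simp
    qed
    have "integral\<^sup>L M (s n) = integral\<^sup>L N (s n)" for n
      using cont bd by (intro eq) (auto simp: bounded_iff)
    then show ?thesis using *[OF assms(1)] *[OF assms(2)] LIMSEQ_unique by fastforce
  qed
  interpret M: prob_space M using assms by (simp add: borel_probs_def)
  interpret N: prob_space N using assms by (simp add: borel_probs_def)
  have sM: "sets M = sets borel" and sN: "sets N = sets borel"
    using assms by (auto simp: borel_probs_def)
  have UN: "emeasure M UNIV = 1" "emeasure N UNIV = 1"
    using M.emeasure_space_1 N.emeasure_space_1 sets_eq_imp_space_eq[OF sM]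
      sets_eq_imp_space_eq[OF sN] by auto
  show ?thesis
  proof (rule measure_eqI_generator_eq[where E = "{U. open U}" and A = "\<lambda>_. UNIV" and \<Omega> = UNIV])
    show "emeasure M U = emeasure N U" if "U \<in> {U. open U}" for U
      using op[of U] that UN
      by (cases "U = UNIV") (auto simp: M.emeasure_eq_measure N.emeasure_eq_measure)
  qed (use sM sN UN in \<open>auto simp: borel_def Int_stable_def\<close>)
qed

lemma mixture_unique:
  fixes \<rho> :: "'a::topological_space \<Rightarrow> 'b::metric_space measure"
  assumes "markov_kernel \<rho>" "\<sigma> \<in> borel_probs" "\<mu> \<in> borel_probs"
  shows "\<mu> = mixture \<rho> \<sigma> \<longleftrightarrow>
    (\<forall>f :: 'b \<Rightarrow> real. continuous_on UNIV f \<and> bounded (range f) \<longrightarrow>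
       (\<integral>y. f y \<partial>\<mu>) = (\<integral>x. (\<integral>y. f y \<partial>\<rho> x) \<partial>\<sigma>))"
  using integral_mixture[OF assms(1,2)]
    borel_probs_eqI[OF assms(3) mixture_in_borel_probs[OF assms(1,2)]] by metis

end

theory Submission
  imports Defs
begin

text \<open>
  Everything rests on the strict convexity of \<open>\<mu> \<mapsto> W\<^sub>p\<^sup>p(\<mu>, \<nu>)\<close> where it is finite. If it fails for
  \<open>\<mu>1\<close> and \<open>\<mu>2\<close>, then the midpoint \<open>\<Gamma>\<close> of two optimal couplings is optimal for the midpoint of
  \<open>\<mu>1\<close> and \<open>\<mu>2\<close>, so it is concentrated on a closed set \<open>S\<close> that satisfies the two-point
  monotonicity of optimal plans. For \<open>p > 1\<close> the points \<open>y\<close> that are paired in \<open>S\<close> with more than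
  one \<open>x\<close> are covered by countably many sets each of which meets every line in some direction at
  most once; such sets are Lebesgue null, hence \<open>\<nu>\<close>-null. Thus \<open>S\<close> is essentially a graph over \<open>y\<close>,
  and both couplings, being concentrated on it, have the same first marginal.

  If the infimum is infinite, every measure is a minimizer, and uniqueness forces the space to be a
  single point, where the cost is finite by the hypothesis on that case.
\<close>

section \<open>Existence of optimal couplings\<close>

text \<open>By Tychonoff, functions into the compact space \<open>ennreal\<close> form a compact
  space, so the sequence \<open>f\<close> has a cluster point \<open>m\<close>. The index type may
  be uncountable, so a convergent subsequence need not exist; the filter \<open>H\<close> takes its
  place. With sets as indices this yields a setwise limit of measures.\<close>

lemma cluster_filter_pointwise:
  fixes f :: "nat \<Rightarrow> 'i \<Rightarrow> ennreal"
  obtains m H where "H \<noteq> bot" "H \<le> sequentially" "\<And>i. ((\<lambda>n. f n i) \<longlongrightarrow> m i) H"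
proof -
  have "compact_space (product_topology (\<lambda>_::'i. euclidean :: ennreal topology) UNIV)"
    unfolding compact_space_product_topology by (auto simp: compact_UNIV compact_space_def)
  then have "compact (UNIV :: ('i \<Rightarrow> ennreal) set)"
    by (simp add: euclidean_product_topology compact_space_def)
  moreover have "filtermap f sequentially \<noteq> bot"
    by (simp add: filtermap_bot_iff)
  ultimately obtain m where m: "inf (nhds m) (filtermap f sequentially) \<noteq> bot"
    unfolding compact_filter by fastforce
  \<comment> \<open>The large indices \<open>n\<close> for which \<open>f n\<close> is close to
    \<open>m\<close>; this filter is nontrivial because \<open>m\<close> is a cluster point.\<close>
  define H where "H = inf (filtercomap f (nhds m)) sequentially"
  have "H \<noteq> bot"
  proof
    assume "H = bot"
    then obtain P Q where P: "eventually P (filtercomap f (nhds m))" and Q: "eventually Q sequentially"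
      and PQ: "\<And>n. P n \<Longrightarrow> Q n \<Longrightarrow> False"
      unfolding H_def trivial_limit_def eventually_inf by auto
    obtain R where R: "eventually R (nhds m)" "\<And>n. R (f n) \<Longrightarrow> P n"
      using P by (auto simp: eventually_filtercomap)
    have "eventually (\<lambda>g. \<not> R g) (filtermap f sequentially)"
      using Q R PQ by (auto simp: eventually_filtermap elim!: eventually_mono)
    with R(1) have "eventually (\<lambda>_. False) (inf (nhds m) (filtermap f sequentially))"
      unfolding eventually_inf by (intro exI[of _ R] exI[of _ "\<lambda>g. \<not> R g"]) auto
    with m show False by (simp add: trivial_limit_def)
  qed
  moreover have "((\<lambda>n. f n i) \<longlongrightarrow> m i) H" for i
  proof -
    have "filterlim f (nhds m) H"
      unfolding H_def by (rule filterlim_mono[OF filterlim_filtercomap]) auto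
    moreover have "filterlim (\<lambda>g. g i) (nhds (m i)) (nhds m)"
      unfolding filterlim_iff
    proof (intro allI impI)
      fix P assume "eventually P (nhds (m i))"
      then obtain U where U: "open U" "m i \<in> U" "\<And>y. y \<in> U \<Longrightarrow> P y"
        by (auto simp: eventually_nhds)
      moreover have "open {g :: 'i \<Rightarrow> ennreal. \<forall>j\<in>{i}. g j \<in> U}"
        using U(1) by (intro product_topology_basis') auto
      ultimately show "eventually (\<lambda>g. P (g i)) (nhds m)"
        unfolding eventually_nhds by (intro exI[of _ "{g. \<forall>j\<in>{i}. g j \<in> U}"]) auto
    qed
    ultimately show ?thesis by (rule filterlim_compose[rotated])
  qed
  ultimately show ?thesis
    using that[of H m] by (simp add: H_def)
qed

section \<open>Regularity of Borel probability measures and extension from rectangles\<close>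

lemma inner_regular_diff:
  fixes M :: "'a::polish_space measure"
  assumes M: "M \<in> borel_probs" and B: "B \<in> sets borel" and e: "e > (0::real)"
  obtains K where "K \<subseteq> B" "compact K" "emeasure M (B - K) \<le> ennreal e"
proof -
  interpret prob_space M using M by (simp add: borel_probs_def)
  have sM: "sets M = sets borel" using M by (simp add: borel_probs_def)
  have "\<exists>K\<in>{K. K \<subseteq> B \<and> compact K}. emeasure M B < emeasure M K + e"
  proof (rule ccontr)
    assume "\<not> ?thesis"
    then have *: "emeasure M K + e \<le> emeasure M B" if "K \<subseteq> B" "compact K" for K
      using that by (auto simp: not_less)
    \<comment> \<open>If no compact subset is \<open>e\<close>-close, the supremum formula of inner
      regularity lowers the measure of \<open>B\<close> by \<open>e\<close>.\<close>
    have "emeasure M K \<le> emeasure M B - e" if "K \<subseteq> B" "compact K" for K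
      using *[OF that] by (simp add: ennreal_le_minus_iff add.commute)
    then have "emeasure M B \<le> emeasure M B - e"
      by (subst inner_regular[OF sM _ B]) (auto intro!: SUP_least)
    \<comment> \<open>Taking the empty set for \<open>K\<close> shows that the subtraction of
      \<open>e\<close> is not truncated at 0, so the inequality just obtained is absurd.\<close>
    moreover have "ennreal e \<le> emeasure M B" using *[of "{}"] by simp
    ultimately show False using e
      by (simp add: emeasure_eq_measure ennreal_minus)
  qed
  then obtain K where K: "K \<subseteq> B" "compact K" "emeasure M B < emeasure M K + e" by auto
  have "emeasure M (B - K) = emeasure M B - emeasure M K"
    using K sM B by (intro emeasure_Diff) (auto intro: borel_compact)
  also have "\<dots> \<le> e" using K(3) by (simp add: ennreal_minus_le_iff)
  finally show ?thesis using that K by blast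
qed

text \<open>Inner regularity for \<open>- B\<close>, read on complements: the complement of a
  compact set is open.\<close>

lemma outer_regular_diff:
  fixes M :: "'a::polish_space measure"
  assumes "M \<in> borel_probs" "B \<in> sets borel" "e > (0::real)"
  obtains U where "B \<subseteq> U" "open U" "emeasure M (U - B) \<le> ennreal e"
proof -
  obtain K where K: "K \<subseteq> - B" "compact K" "emeasure M (- B - K) \<le> ennreal e"
    using inner_regular_diff[OF assms(1), of "- B" e] assms by (auto simp: borel_comp)
  have "- K - B = - B - K" by auto
  with K show ?thesis by (intro that[of "- K"]) (auto simp: compact_imp_closed)
qed

text \<open>Inner regularity of the two marginals gives a compactness argument that upgrades finite
  additivity on the product to countable additivity on rectangles.\<close>

lemma measure_from_marginals:
  fixes f :: "('a::polish_space \<times> 'b::polish_space) set \<Rightarrow> ennreal"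
  assumes pos: "positive (sets borel) f" and add: "additive (sets borel) f"
    and \<mu>: "\<mu> \<in> borel_probs" "\<And>A. A \<in> sets borel \<Longrightarrow> f (A \<times> UNIV) = emeasure \<mu> A"
    and \<nu>: "\<nu> \<in> borel_probs" "\<And>B. B \<in> sets borel \<Longrightarrow> f (UNIV \<times> B) = emeasure \<nu> B"
  obtains \<Gamma> where "\<Gamma> \<in> borel_probs"
    "\<And>A B. A \<in> sets borel \<Longrightarrow> B \<in> sets borel \<Longrightarrow> emeasure \<Gamma> (A \<times> B) = f (A \<times> B)"
proof -
  define R :: "('a \<times> 'b) set set" where "R = {A \<times> B |A B. A \<in> sets borel \<and> B \<in> sets borel}"
  have rect: "A \<times> B \<in> sets borel" if "A \<in> sets borel" "B \<in> sets borel" for A :: "'a set" and B :: "'b set"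
    using that by (rule borel_Times)
  have RB: "R \<subseteq> sets borel" using rect by (auto simp: R_def)
  interpret B: sigma_algebra "UNIV :: ('a \<times> 'b) set" "sets borel"
    using sets.sigma_algebra_axioms[of "borel :: ('a \<times> 'b) measure"] by simp
  have inc: "f X \<le> f Y" if "X \<subseteq> Y" "X \<in> sets borel" "Y \<in> sets borel" for X Y
    using B.additive_increasing[OF pos add] that by (auto simp: increasing_def)
  have sub2: "f (X \<union> Y) \<le> f X + f Y" if "X \<in> sets borel" "Y \<in> sets borel" for X Y
  proof -
    have "f (X \<union> Y) = f X + f (Y - X)"
      using additiveD[OF add, of X "Y - X"] that by auto
    also have "\<dots> \<le> f X + f Y" using that by (intro add_left_mono inc) auto
    finally show ?thesis .
  qed
  interpret R: semiring_of_sets UNIV R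
  proof
    show "R \<subseteq> Pow UNIV" "{} \<in> R" by (auto simp: R_def intro!: exI[of _ "{}"])
    show "a \<inter> b \<in> R" if "a \<in> R" "b \<in> R" for a b
      using that by (auto simp: R_def Times_Int_Times) (metis sets.Int)
    show "\<exists>C\<subseteq>R. finite C \<and> disjoint C \<and> a - b = \<Union>C" if "a \<in> R" "b \<in> R" for a b
    proof -
      obtain A1 B1 A2 B2 where ab: "a = A1 \<times> B1" "b = A2 \<times> B2"
        "A1 \<in> sets borel" "B1 \<in> sets borel" "A2 \<in> sets borel" "B2 \<in> sets borel"
        using \<open>a \<in> R\<close> \<open>b \<in> R\<close> unfolding R_def by blast
      let ?C = "{(A1 - A2) \<times> B1, (A1 \<inter> A2) \<times> (B1 - B2)}"
      have "?C \<subseteq> R" using ab(3-6) by (auto simp: R_def; blast)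
      moreover have "disjoint ?C" by (auto simp: disjoint_def)
      moreover have "a - b = \<Union>?C" using ab by auto
      ultimately show ?thesis by blast
    qed
  qed
  have approx: "f (A \<times> B) \<le> (\<Sum>k. f (D k)) + ennreal e"
    if A: "A \<in> sets borel" and B: "B \<in> sets borel" and D: "range D \<subseteq> R" "A \<times> B = (\<Union>k. D k)"
      and e: "e > 0" for A B D and e :: real
  proof -
    have "\<exists>A B. D k = A \<times> B \<and> A \<in> sets borel \<and> B \<in> sets borel" for k
    proof -
      have "D k \<in> R" using D(1) by auto
      then show ?thesis unfolding R_def by blast
    qed
    then obtain a b where ab: "\<And>k. D k = a k \<times> b k" "\<And>k. a k \<in> sets borel" "\<And>k. b k \<in> sets borel"
      by metis
    obtain K where K: "K \<subseteq> A" "compact K" "emeasure \<mu> (A - K) \<le> ennreal (e/4)"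
      using inner_regular_diff[OF \<mu>(1) A, of "e/4"] e by auto
    obtain L where L: "L \<subseteq> B" "compact L" "emeasure \<nu> (B - L) \<le> ennreal (e/4)"
      using inner_regular_diff[OF \<nu>(1) B, of "e/4"] e by auto
    \<comment> \<open>The \<open>d k\<close> sum to \<open>e/4\<close> and are spent on both
      factors, so enlarging all rectangles to open ones costs \<open>e/2\<close>; shrinking
      \<open>A\<close> and \<open>B\<close> to the compact \<open>K\<close> and \<open>L\<close>
      costs another \<open>e/4\<close> each.\<close>
    define d where "d k = e/4 * (1/2)^Suc k" for k
    have d: "d k > 0" for k using e by (simp add: d_def)
    have "\<forall>k. \<exists>U. a k \<subseteq> U \<and> open U \<and> emeasure \<mu> (U - a k) \<le> ennreal (d k)"
      using outer_regular_diff[OF \<mu>(1) ab(2) d] by metis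
    then obtain U where U: "\<And>k. a k \<subseteq> U k" "\<And>k. open (U k)" "\<And>k. emeasure \<mu> (U k - a k) \<le> ennreal (d k)"
      by metis
    have "\<forall>k. \<exists>V. b k \<subseteq> V \<and> open V \<and> emeasure \<nu> (V - b k) \<le> ennreal (d k)"
      using outer_regular_diff[OF \<nu>(1) ab(3) d] by metis
    then obtain V where V: "\<And>k. b k \<subseteq> V k" "\<And>k. open (V k)" "\<And>k. emeasure \<nu> (V k - b k) \<le> ennreal (d k)"
      by metis
    have meas: "K \<in> sets borel" "L \<in> sets borel" "\<And>k. U k \<in> sets borel" "\<And>k. V k \<in> sets borel"
      using K(2) L(2) U(2) V(2) by (auto intro: borel_compact)
    have Dm: "D k \<in> sets borel" for k using ab by (auto intro!: rect)
    have UVle: "f (U k \<times> V k) \<le> f (D k) + ennreal (2 * d k)" for k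
    proof -
      have "f (U k \<times> V k) \<le> f (D k \<union> ((U k - a k) \<times> UNIV \<union> UNIV \<times> (V k - b k)))"
        using ab meas Dm by (intro inc sets.Un rect sets.Diff) auto
      also have "\<dots> \<le> f (D k) + f ((U k - a k) \<times> UNIV \<union> UNIV \<times> (V k - b k))"
        using ab meas Dm by (intro sub2 sets.Un rect sets.Diff) auto
      also have "\<dots> \<le> f (D k) + (f ((U k - a k) \<times> UNIV) + f (UNIV \<times> (V k - b k)))"
        using ab meas Dm by (intro add_left_mono sub2 sets.Un rect sets.Diff) auto
      also have "\<dots> = f (D k) + (emeasure \<mu> (U k - a k) + emeasure \<nu> (V k - b k))"
        using ab meas by (subst \<mu>(2), simp, subst \<nu>(2), auto)
      also have "\<dots> \<le> f (D k) + (ennreal (d k) + ennreal (d k))"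
        using U(3) V(3) by (intro add_left_mono add_mono)
      finally show ?thesis
        using d[of k] by (simp add: ennreal_plus[symmetric] del: ennreal_plus)
    qed
    have "compact (K \<times> L)" using K L by (intro compact_Times)
    moreover have "K \<times> L \<subseteq> (\<Union>k\<in>UNIV. U k \<times> V k)"
    proof -
      have "K \<times> L \<subseteq> (\<Union>k. D k)" using K(1) L(1) D(2) by blast
      also have "\<dots> \<subseteq> (\<Union>k. U k \<times> V k)" using U(1) V(1) by (fastforce simp: ab(1))
      finally show ?thesis .
    qed
    moreover have "open (U k \<times> V k)" for k using U(2) V(2) by (rule open_Times)
    \<comment> \<open>Compactness leaves finitely many open rectangles, and for these finite
      subadditivity of \<open>f\<close> is enough.\<close>
    ultimately obtain I where I: "finite I" "K \<times> L \<subseteq> (\<Union>k\<in>I. U k \<times> V k)"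
      using compactE_image[of "K \<times> L" UNIV "\<lambda>k. U k \<times> V k" thesis] by blast
    have "f (A \<times> B) \<le> f ((K \<times> L) \<union> ((A - K) \<times> UNIV \<union> UNIV \<times> (B - L)))"
      using A B meas by (intro inc sets.Un rect sets.Diff) auto
    also have "\<dots> \<le> f (K \<times> L) + f ((A - K) \<times> UNIV \<union> UNIV \<times> (B - L))"
      using A B meas by (intro sub2 sets.Un rect sets.Diff) auto
    also have "\<dots> \<le> f (K \<times> L) + (f ((A - K) \<times> UNIV) + f (UNIV \<times> (B - L)))"
      using A B meas by (intro add_left_mono sub2 sets.Un rect sets.Diff) auto
    also have "\<dots> = f (K \<times> L) + (emeasure \<mu> (A - K) + emeasure \<nu> (B - L))"
      using A B meas by (subst \<mu>(2), simp, subst \<nu>(2), auto)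
    also have "\<dots> \<le> f (K \<times> L) + (ennreal (e/4) + ennreal (e/4))"
      using K(3) L(3) by (intro add_left_mono add_mono)
    also have "f (K \<times> L) \<le> f (\<Union>k\<in>I. U k \<times> V k)"
      using I meas by (intro inc sets.finite_UN) (auto intro!: rect sets.Un sets.Diff)
    also have "\<dots> \<le> (\<Sum>k\<in>I. f (U k \<times> V k))"
      using meas I(1) by (intro B.subadditive[OF pos add]) (auto intro!: rect sets.Un sets.Diff)
    also have "\<dots> \<le> (\<Sum>k\<in>I. f (D k) + ennreal (2 * d k))"
      by (intro sum_mono UVle)
    also have "\<dots> = (\<Sum>k\<in>I. f (D k)) + (\<Sum>k\<in>I. ennreal (2 * d k))"
      by (rule sum.distrib)
    also have "(\<Sum>k\<in>I. f (D k)) \<le> (\<Sum>k. f (D k))"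
      by (rule sum_le_suminf) (use I in auto)
    also have "(\<Sum>k\<in>I. ennreal (2 * d k)) \<le> (\<Sum>k. ennreal (2 * d k))"
      by (rule sum_le_suminf) (use I in auto)
    also have "(\<Sum>k. ennreal (2 * d k)) = ennreal (e/2)"
    proof (rule suminf_ennreal_eq)
      show "(\<lambda>k. 2 * d k) sums (e/2)"
        using sums_mult[OF power_half_series, of "e/2"] by (simp add: d_def field_simps)
    qed (use d in \<open>simp add: less_imp_le\<close>)
    finally show ?thesis
      using e by (simp add: ennreal_plus[symmetric] add.assoc add_ac del: ennreal_plus)
  qed
  have "countably_additive R f"
  proof (rule countably_additiveI)
    fix D :: "nat \<Rightarrow> ('a \<times> 'b) set"
    assume D: "range D \<subseteq> R" "disjoint_family D" "(\<Union>k. D k) \<in> R"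
    then obtain A B where AB: "(\<Union>k. D k) = A \<times> B" "A \<in> sets borel" "B \<in> sets borel"
      unfolding R_def by blast
    show "(\<Sum>k. f (D k)) = f (\<Union>k. D k)"
    proof (rule antisym)
      have "(\<Sum>k<n. f (D k)) \<le> f (\<Union>k. D k)" for n
      proof -
        have Dm: "D k \<in> sets borel" for k using D(1) RB by auto
        have "(\<Sum>k<n. f (D k)) = f (\<Union>k<n. D k)"
          using Dm D(2) by (intro B.additive_sum[OF pos add])
            (auto simp: disjoint_family_on_def)
        also have "\<dots> \<le> f (\<Union>k. D k)"
          using Dm by (intro inc) auto
        finally show ?thesis .
      qed
      then show "(\<Sum>k. f (D k)) \<le> f (\<Union>k. D k)"
        by (intro suminf_le_const) auto
      show "f (\<Union>k. D k) \<le> (\<Sum>k. f (D k))"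
        unfolding AB(1) using approx[OF AB(2,3) D(1) AB(1)[symmetric]] by (rule ennreal_le_epsilon)
    qed
  qed
  moreover have "positive R f" using pos by (auto simp: positive_def)
  \<comment> \<open>The Caratheodory extension is only known to agree with \<open>f\<close> on
    rectangles; on other Borel sets the two may differ.\<close>
  ultimately obtain m where m: "\<And>s. s \<in> R \<Longrightarrow> m s = f s" "measure_space UNIV (sigma_sets UNIV R) m"
    using R.caratheodory by metis
  define \<Gamma> where "\<Gamma> = measure_of UNIV R m"
  have sets\<Gamma>: "sets \<Gamma> = sets borel"
  proof -
    have "sets \<Gamma> = sets ((borel :: 'a measure) \<Otimes>\<^sub>M (borel :: 'b measure))"
      unfolding \<Gamma>_def sets_pair_measure R_def by simp
    then show ?thesis unfolding borel_prod .
  qed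
  have em: "emeasure \<Gamma> (A \<times> B) = f (A \<times> B)" if "A \<in> sets borel" "B \<in> sets borel" for A B
  proof -
    have *: "A \<times> B \<in> R" using that by (auto simp: R_def)
    have "emeasure \<Gamma> (A \<times> B) = m (A \<times> B)"
      unfolding \<Gamma>_def
      by (rule emeasure_measure_of[OF refl]) (use m(2) * in \<open>auto simp: measure_space_def\<close>)
    then show ?thesis using m(1)[OF *] by simp
  qed
  have "emeasure \<Gamma> (UNIV \<times> UNIV) = emeasure \<mu> UNIV"
    using em[of UNIV UNIV] \<mu>(2)[of UNIV] by simp
  also have "\<dots> = 1"
    using \<mu>(1) prob_space.emeasure_space_1[of \<mu>] sets_eq_imp_space_eq[of \<mu> borel]
    by (auto simp: borel_probs_def)
  finally have "prob_space \<Gamma>"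
    using sets_eq_imp_space_eq[OF sets\<Gamma>] by (intro prob_spaceI) auto
  then show ?thesis using that[of \<Gamma>] sets\<Gamma> em by (simp add: borel_probs_def)
qed

lemma couplings_emeasure:
  assumes \<Gamma>: "\<Gamma> \<in> couplings \<mu> \<nu>"
  shows "A \<in> sets borel \<Longrightarrow> emeasure \<Gamma> (A \<times> UNIV) = emeasure \<mu> A"
    and "B \<in> sets borel \<Longrightarrow> emeasure \<Gamma> (UNIV \<times> B) = emeasure \<nu> B"
proof -
  have s: "sets \<Gamma> = sets borel" and m: "distr \<Gamma> borel fst = \<mu>" "distr \<Gamma> borel snd = \<nu>"
    using \<Gamma> by (auto simp: couplings_def borel_probs_def)
  have f: "fst \<in> borel_measurable \<Gamma>" "snd \<in> borel_measurable \<Gamma>"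
    unfolding measurable_cong_sets[OF s refl]
    by (auto intro!: borel_measurable_continuous_onI continuous_intros)
  show "emeasure \<Gamma> (A \<times> UNIV) = emeasure \<mu> A" if "A \<in> sets borel"
    using emeasure_distr[OF f(1) that] sets_eq_imp_space_eq[OF s] m by (simp add: fst_vimage_eq_Times)
  show "emeasure \<Gamma> (UNIV \<times> B) = emeasure \<nu> B" if "B \<in> sets borel"
    using emeasure_distr[OF f(2) that] sets_eq_imp_space_eq[OF s] m by (simp add: snd_vimage_eq_Times)
qed

lemma couplingsI:
  fixes \<mu> :: "'a::{second_countable_topology} measure"
  assumes \<Gamma>: "\<Gamma> \<in> borel_probs" and s: "sets \<mu> = sets borel" "sets \<nu> = sets borel"
    and 1: "\<And>A. A \<in> sets borel \<Longrightarrow> emeasure \<Gamma> (A \<times> UNIV) = emeasure \<mu> A"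
    and 2: "\<And>B. B \<in> sets borel \<Longrightarrow> emeasure \<Gamma> (UNIV \<times> B) = emeasure \<nu> B"
  shows "\<Gamma> \<in> couplings \<mu> \<nu>"
proof -
  have s\<Gamma>: "sets \<Gamma> = sets borel" using \<Gamma> by (auto simp: borel_probs_def)
  have f: "fst \<in> borel_measurable \<Gamma>" "snd \<in> borel_measurable \<Gamma>"
    unfolding measurable_cong_sets[OF s\<Gamma> refl]
    by (auto intro!: borel_measurable_continuous_onI continuous_intros)
  have "distr \<Gamma> borel fst = \<mu>"
    using s 1 sets_eq_imp_space_eq[OF s\<Gamma>] 
    by (intro measure_eqI) (simp_all add: emeasure_distr[OF f(1)] fst_vimage_eq_Times)
  moreover have "distr \<Gamma> borel snd = \<nu>"
    using s 2 sets_eq_imp_space_eq[OF s\<Gamma>] 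
    by (intro measure_eqI) (simp_all add: emeasure_distr[OF f(2)] snd_vimage_eq_Times)
  ultimately show ?thesis using \<Gamma> by (simp add: couplings_def)
qed

text \<open>The direct method. A minimizing sequence of couplings has a setwise cluster point
  \<open>m\<close>, which is finitely additive and has the right marginals; its values on rectangles
  extend to a coupling. The cost of this coupling does not exceed the infimum, by approximation from
  below with step functions.\<close>

lemma optimal_coupling_exists:
  fixes \<mu> \<nu> :: "'b::euclidean_space measure"
  assumes p: "p > 0" and \<mu>: "\<mu> \<in> borel_probs" and \<nu>: "\<nu> \<in> borel_probs"
    and fin: "wasserstein_pow p \<mu> \<nu> < \<infinity>"
  obtains \<Gamma> where "\<Gamma> \<in> couplings \<mu> \<nu>"
    "(\<integral>\<^sup>+ z. ennreal (norm (fst z - snd z) powr p) \<partial>\<Gamma>) = wasserstein_pow p \<mu> \<nu>"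
proof -
  let ?W = "wasserstein_pow p \<mu> \<nu>" and ?c = "\<lambda>z::'b \<times> 'b. norm (fst z - snd z) powr p"
  have "\<exists>\<Gamma>\<in>couplings \<mu> \<nu>. (\<integral>\<^sup>+ z. ennreal (?c z) \<partial>\<Gamma>) < ?W + ennreal (1 / real (Suc n))" for n
  proof -
    \<comment> \<open>Finiteness of \<open>?W\<close> makes this strict, so near-minimizers
      exist.\<close>
    have "?W < ?W + ennreal (1 / real (Suc n))"
      using fin by (cases ?W) (auto simp: ennreal_plus[symmetric] ennreal_less_iff simp del: ennreal_plus)
    then show ?thesis unfolding wasserstein_pow_def INF_less_iff .
  qed
  then obtain G where G: "\<And>n. G n \<in> couplings \<mu> \<nu>"
    "\<And>n. (\<integral>\<^sup>+ z. ennreal (?c z) \<partial>G n) < ?W + ennreal (1 / real (Suc n))"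
    by metis
  have sG: "sets (G n) = sets borel" for n using G(1)[of n] by (simp add: couplings_def borel_probs_def)
  obtain m H where H: "H \<noteq> bot" "H \<le> sequentially" "\<And>A. ((\<lambda>n. emeasure (G n) A) \<longlongrightarrow> m A) H"
    using cluster_filter_pointwise[of "\<lambda>n. emeasure (G n)"] by metis
  \<comment> \<open>All \<open>G n\<close> give the same mass to a strip
    \<open>A \<times> UNIV\<close> or \<open>UNIV \<times> B\<close>, hence so does the limit; this
    is how the marginals survive.\<close>
  have m_eq: "m A = a" if "\<And>n. emeasure (G n) A = a" for A a
    using tendsto_unique[OF H(1) H(3)[of A, unfolded that] tendsto_const] by simp
  have pos: "positive (sets borel) m"
    unfolding positive_def using m_eq[of "{}" 0] by simp
  have add: "additive (sets borel) m"
    unfolding additive_def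
  proof (intro ballI impI)
    fix X Y :: "('b \<times> 'b) set" assume XY: "X \<in> sets borel" "Y \<in> sets borel" "X \<inter> Y = {}"
    have "((\<lambda>n. emeasure (G n) X + emeasure (G n) Y) \<longlongrightarrow> m X + m Y) H"
      by (intro tendsto_add H)
    moreover have "emeasure (G n) X + emeasure (G n) Y = emeasure (G n) (X \<union> Y)" for n
      using XY sG by (intro plus_emeasure) auto
    ultimately show "m (X \<union> Y) = m X + m Y"
      using tendsto_unique[OF H(1) H(3)[of "X \<union> Y"]] by simp
  qed
  have marg1: "m (A \<times> UNIV) = emeasure \<mu> A" if "A \<in> sets borel" for A
    by (rule m_eq) (rule couplings_emeasure(1)[OF G(1) that])
  have marg2: "m (UNIV \<times> B) = emeasure \<nu> B" if "B \<in> sets borel" for B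
    by (rule m_eq) (rule couplings_emeasure(2)[OF G(1) that])
  obtain \<Gamma> where \<Gamma>: "\<Gamma> \<in> borel_probs"
    and rect: "\<And>A B. A \<in> sets borel \<Longrightarrow> B \<in> sets borel \<Longrightarrow> emeasure \<Gamma> (A \<times> B) = m (A \<times> B)"
    using measure_from_marginals[OF pos add \<mu> marg1 \<nu> marg2] by blast
  have s\<Gamma>: "sets \<Gamma> = sets borel" using \<Gamma> by (simp add: borel_probs_def)
  have \<Gamma>c: "\<Gamma> \<in> couplings \<mu> \<nu>"
    using \<Gamma> \<mu> \<nu> rect marg1 marg2 by (intro couplingsI) (auto simp: borel_probs_def)
  obtain D :: "nat \<Rightarrow> 'b" where D: "\<And>U. open U \<Longrightarrow> U \<noteq> {} \<Longrightarrow> \<exists>n. D n \<in> U"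
  proof -
    obtain Ds :: "'b set" where Ds: "countable Ds" "\<And>U. open U \<Longrightarrow> U \<noteq> {} \<Longrightarrow> \<exists>d\<in>Ds. d \<in> U"
      using countable_dense_setE by blast
    then have "Ds \<noteq> {}" using Ds(2)[of UNIV] by auto
    then have "range (from_nat_into Ds) = Ds" using Ds(1) by (rule range_from_nat_into)
    then show ?thesis by (intro that[of "from_nat_into Ds"]) (use Ds(2) in \<open>force\<close>)
  qed
  text \<open>Only values on rectangles pass to the limit along \<open>H\<close>, so the cost is bounded below
    by functions that are constant on the cells of a countable partition into rectangles.\<close>
  have approx: "(\<integral>\<^sup>+ z. ennreal (max 0 (norm (fst z - snd z) - 4 * \<delta>) powr p) \<partial>\<Gamma>) \<le> ?W" if \<delta>: "\<delta> > 0" for \<delta> :: real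
  proof -
    \<comment> \<open>Balls of radius \<open>\<delta>\<close> around a dense sequence, made
      disjoint, partition the space into cells.\<close>
    define A where "A = disjointed (\<lambda>k. ball (D k) \<delta>)"
    have "range (\<lambda>k. ball (D k) \<delta>) \<subseteq> sets borel" by auto
    from sets.range_disjointed_sets[OF this] have Am: "A k \<in> sets borel" for k
      by (auto simp: A_def)
    have Ad: "x \<in> A i \<Longrightarrow> dist (D i) x < \<delta>" for i x
      using disjointed_subset[of "\<lambda>k. ball (D k) \<delta>" i] by (auto simp: A_def)
    have A1: "x \<in> A i \<Longrightarrow> x \<in> A j \<Longrightarrow> i = j" for i j x
      using disjoint_family_disjointed[of "\<lambda>k. ball (D k) \<delta>"] by (auto simp: A_def disjoint_family_on_def)
    have AU: "\<exists>i. x \<in> A i" for x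
    proof -
      have "\<exists>k. D k \<in> ball x \<delta>" using D[of "ball x \<delta>"] \<delta> by auto
      then have "x \<in> (\<Union>k. ball (D k) \<delta>)" by (auto simp: dist_commute)
      then have "x \<in> (\<Union>k. A k)" unfolding A_def UN_disjointed_eq .
      then show ?thesis by auto
    qed
    define R where "R k = A (fst (prod_decode k)) \<times> A (snd (prod_decode k))" for k
    \<comment> \<open>Points of a cell are within \<open>\<delta>\<close> of its centre. Thus the
      distance of two centres, lowered by \<open>2 * \<delta>\<close>, is at most the distance of
      the points and at least that distance lowered by \<open>4 * \<delta>\<close>.\<close>
    define a where "a k = max 0 (dist (D (fst (prod_decode k))) (D (snd (prod_decode k))) - 2 * \<delta>) powr p" for k
    have Rm: "R k \<in> sets borel" for k unfolding R_def by (intro borel_Times Am)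
    have ab: "dist (D i) (D j) - 2 * \<delta> \<le> norm (x - y) \<and> norm (x - y) - 4 * \<delta> \<le> dist (D i) (D j) - 2 * \<delta>"
      if "x \<in> A i" "y \<in> A j" for x y i j
    proof -
      have "dist (D i) (D j) \<le> dist (D i) x + dist x y + dist y (D j)"
        using dist_triangle[of "D i" "D j" x] dist_triangle[of x "D j" y] by linarith
      moreover have "dist x y \<le> dist x (D i) + dist (D i) (D j) + dist (D j) y"
        using dist_triangle[of x y "D i"] dist_triangle[of "D i" y "D j"] by linarith
      ultimately show ?thesis
        unfolding dist_norm[symmetric, of x y]
        using Ad[OF that(1)] Ad[OF that(2)] dist_commute[of x "D i"] dist_commute[of y "D j"]
        by (intro conjI) linarith+
    qed
    have idx: "\<exists>k. z \<in> R k \<and> (\<forall>j. z \<in> R j \<longrightarrow> j = k) \<and> a k \<le> ?c z \<and> max 0 (norm (fst z - snd z) - 4 * \<delta>) powr p \<le> a k" for z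
    proof -
      obtain i j where ij: "fst z \<in> A i" "snd z \<in> A j" using AU[of "fst z"] AU[of "snd z"] by blast
      let ?k = "prod_encode (i, j)"
      have "z \<in> R ?k" using ij by (auto simp: R_def mem_Times_iff)
      moreover have "l = ?k" if "z \<in> R l" for l
      proof -
        have "prod_decode l = (i, j)"
          using that ij A1 by (cases "prod_decode l") (auto simp: R_def)
        then show ?thesis by (metis prod_decode_inverse)
      qed
      moreover have "a ?k \<le> ?c z" "max 0 (norm (fst z - snd z) - 4 * \<delta>) powr p \<le> a ?k"
        using ab[OF ij] p by (auto simp: a_def intro!: powr_mono2)
      ultimately show ?thesis by (intro exI[of _ ?k]) blast
    qed
    have fsum: "(\<Sum>k<N. ennreal (a k) * indicator (R k) z) \<le> ennreal (?c z)" for N z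
    proof -
      obtain k where k: "z \<in> R k" "\<And>j. z \<in> R j \<Longrightarrow> j = k" "a k \<le> ?c z" using idx[of z] by blast
      have "(\<Sum>j<N. ennreal (a j) * indicator (R j) z) = (\<Sum>j<N. if j = k then ennreal (a k) else 0)"
      proof (rule sum.cong[OF refl])
        fix j
        have "z \<notin> R j" if "j \<noteq> k" using k(2)[of j] that by blast
        then show "ennreal (a j) * indicator (R j) z = (if j = k then ennreal (a k) else 0)"
          using k(1) by (cases "j = k") auto
      qed
      also have "\<dots> \<le> ennreal (a k)" by (simp add: sum.delta)
      also have "\<dots> \<le> ennreal (?c z)" using k(3) by (rule ennreal_leI)
      finally show ?thesis .
    qed
    have "(\<integral>\<^sup>+ z. ennreal (max 0 (norm (fst z - snd z) - 4 * \<delta>) powr p) \<partial>\<Gamma>)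
        \<le> (\<integral>\<^sup>+ z. (\<Sum>k. ennreal (a k) * indicator (R k) z) \<partial>\<Gamma>)"
    proof (intro nn_integral_mono)
      fix z
      obtain k where k: "z \<in> R k" "max 0 (norm (fst z - snd z) - 4 * \<delta>) powr p \<le> a k" using idx[of z] by blast
      have "ennreal (max 0 (norm (fst z - snd z) - 4 * \<delta>) powr p) \<le> (\<Sum>j\<in>{k}. ennreal (a j) * indicator (R j) z)"
        using k by (auto intro: ennreal_leI)
      also have "\<dots> \<le> (\<Sum>j. ennreal (a j) * indicator (R j) z)" by (rule sum_le_suminf) auto
      finally show "ennreal (max 0 (norm (fst z - snd z) - 4 * \<delta>) powr p) \<le> (\<Sum>j. ennreal (a j) * indicator (R j) z)" .
    qed
    also have "\<dots> = (\<Sum>k. ennreal (a k) * emeasure \<Gamma> (R k))"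
      using Rm s\<Gamma> by (subst nn_integral_suminf) (auto simp: nn_integral_cmult_indicator)
    also have "\<dots> \<le> ?W"
    proof (rule suminf_le_const)
      fix N
      have "((\<lambda>n. \<Sum>k<N. ennreal (a k) * emeasure (G n) (R k)) \<longlongrightarrow> (\<Sum>k<N. ennreal (a k) * emeasure \<Gamma> (R k))) H"
        using H(3) rect[OF Am Am]
        by (intro tendsto_sum ennreal_tendsto_cmult) (auto simp: R_def)
      moreover have "((\<lambda>n. ?W + ennreal (1 / real (Suc n))) \<longlongrightarrow> ?W + ennreal 0) H"
        using LIMSEQ_inverse_real_of_nat
        by (intro tendsto_mono[OF H(2)] tendsto_add tendsto_const tendsto_ennrealI) (simp add: inverse_eq_divide)
      moreover have "(\<Sum>k<N. ennreal (a k) * emeasure (G n) (R k)) \<le> ?W + ennreal (1 / real (Suc n))" for n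
      proof -
        have RG: "R k \<in> sets (G n)" for k using Rm sG by simp
        have "(\<Sum>k<N. ennreal (a k) * emeasure (G n) (R k)) = (\<integral>\<^sup>+ z. (\<Sum>k<N. ennreal (a k) * indicator (R k) z) \<partial>G n)"
          using RG by (subst nn_integral_sum)
            (auto simp: nn_integral_cmult_indicator intro!: borel_measurable_times_ennreal borel_measurable_indicator)
        also have "\<dots> \<le> (\<integral>\<^sup>+ z. ennreal (?c z) \<partial>G n)" by (intro nn_integral_mono fsum)
        finally show ?thesis using G(2)[of n] by simp
      qed
      ultimately show "(\<Sum>k<N. ennreal (a k) * emeasure \<Gamma> (R k)) \<le> ?W"
        using tendsto_le[OF H(1)] by (metis (no_types, lifting) add.right_neutral always_eventually ennreal_0)
    qed auto
    finally show ?thesis .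
  qed
  let ?u = "\<lambda>n z. ennreal (max 0 (norm (fst z - snd z :: 'b) - 4 * (1 / real (Suc n))) powr p)"
  have lim: "(\<lambda>n. ?u n z) \<longlonglongrightarrow> ennreal (?c z)" for z
  proof -
    have "(\<lambda>n. max 0 (norm (fst z - snd z) - 4 * (1 / real (Suc n)))) \<longlonglongrightarrow> max 0 (norm (fst z - snd z) - 4 * 0)"
      using LIMSEQ_inverse_real_of_nat by (intro tendsto_intros) (simp add: inverse_eq_divide)
    then have "(\<lambda>n. max 0 (norm (fst z - snd z) - 4 * (1 / real (Suc n))) powr p) \<longlonglongrightarrow> ?c z"
      using p by (intro tendsto_powr') auto
    then show ?thesis by (rule tendsto_ennrealI)
  qed
  \<comment> \<open>Fatou's lemma along \<open>\<delta> = 1 / real (Suc n)\<close> removes the loss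
    of \<open>4 * \<delta>\<close>.\<close>
  have "(\<integral>\<^sup>+ z. ennreal (?c z) \<partial>\<Gamma>) = (\<integral>\<^sup>+ z. liminf (\<lambda>n. ?u n z) \<partial>\<Gamma>)"
    using lim_imp_Liminf[OF sequentially_bot lim] by simp
  also have "\<dots> \<le> liminf (\<lambda>n. \<integral>\<^sup>+ z. ?u n z \<partial>\<Gamma>)"
  proof (rule nn_integral_liminf)
    fix n
    have "(\<lambda>z::'b \<times> 'b. max 0 (norm (fst z - snd z) - 4 * (1 / real (Suc n)))) \<in> borel_measurable borel"
      by (intro borel_measurable_continuous_onI continuous_intros)
    then show "?u n \<in> borel_measurable \<Gamma>"
      unfolding measurable_cong_sets[OF s\<Gamma> refl] by measurable
  qed
  also have "\<dots> \<le> ?W"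
    by (intro Liminf_le always_eventually allI approx) simp_all
  finally have "(\<integral>\<^sup>+ z. ennreal (?c z) \<partial>\<Gamma>) \<le> ?W" .
  moreover have "?W \<le> (\<integral>\<^sup>+ z. ennreal (?c z) \<partial>\<Gamma>)"
    unfolding wasserstein_pow_def using \<Gamma>c by (rule INF_lower)
  ultimately show ?thesis using that \<Gamma>c by (meson antisym)
qed

section \<open>Monotonicity of optimal couplings\<close>

text \<open>Two independent pairs are drawn from \<open>\<Gamma>\<close>, and their second coordinates are exchanged on
  the event \<open>D\<close> where this lowers the total cost. Since the event is symmetric in the two
  pairs, the first resulting pair is again distributed according to a coupling of the same marginals.\<close>

lemma optimal_coupling_swap:
  fixes c :: "'b::{second_countable_topology,t2_space} \<times> 'b \<Rightarrow> real"
  assumes \<Gamma>: "\<Gamma> \<in> couplings \<mu> \<nu>" and c[measurable]: "c \<in> borel_measurable borel" and c0: "\<And>z. c z \<ge> 0"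
    and fin: "(\<integral>\<^sup>+ z. ennreal (c z) \<partial>\<Gamma>) < \<infinity>"
    and opt: "\<And>\<Gamma>'. \<Gamma>' \<in> couplings \<mu> \<nu> \<Longrightarrow> (\<integral>\<^sup>+ z. ennreal (c z) \<partial>\<Gamma>) \<le> (\<integral>\<^sup>+ z. ennreal (c z) \<partial>\<Gamma>')"
  shows "AE w in \<Gamma> \<Otimes>\<^sub>M \<Gamma>.
    c (fst w) + c (snd w) \<le> c (fst (fst w), snd (snd w)) + c (fst (snd w), snd (fst w))"
proof -
  have s\<Gamma>[measurable_cong]: "sets \<Gamma> = sets borel" and p\<Gamma>: "prob_space \<Gamma>"
    and m1: "distr \<Gamma> borel fst = \<mu>" and m2: "distr \<Gamma> borel snd = \<nu>"
    using \<Gamma> by (auto simp: couplings_def borel_probs_def)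
  interpret \<Gamma>: prob_space \<Gamma> by fact
  interpret P: pair_prob_space \<Gamma> \<Gamma> ..
  let ?P = "\<Gamma> \<Otimes>\<^sub>M \<Gamma>"
  have [measurable]: "fst \<in> borel_measurable \<Gamma>" "snd \<in> borel_measurable \<Gamma>"
    unfolding measurable_cong_sets[OF s\<Gamma> refl] by (auto intro!: borel_measurable_continuous_onI continuous_intros)
  have pairm[measurable]: "(\<lambda>w. (f w, g w)) \<in> borel_measurable M"
    if "f \<in> borel_measurable M" "g \<in> borel_measurable M" for M :: "'m measure" and f g :: "'m \<Rightarrow> 'b"
    using that by (rule borel_measurable_Pair)
  have cm[measurable]: "(\<lambda>w. c (f w)) \<in> borel_measurable M" if "f \<in> borel_measurable M" for M :: "'m measure" and f
    using that by measurable
  define d where "d w = c (fst (fst w), snd (snd w)) + c (fst (snd w), snd (fst w))" for w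
  define D where "D w \<longleftrightarrow> d w < c (fst w) + c (snd w)" for w
  define sw where "sw w = (snd w, fst w)" for w :: "('b \<times> 'b) \<times> ('b \<times> 'b)"
  define T where "T w = (fst (fst w), if D w then snd (snd w) else snd (fst w))" for w
  have fs[measurable]: "(\<lambda>w. fst w) \<in> borel_measurable ?P" "(\<lambda>w. snd w) \<in> borel_measurable ?P"
    by (simp_all add: measurable_cong_sets[OF refl s\<Gamma>, symmetric])
  have [measurable]: "Measurable.pred ?P D" unfolding D_def d_def by measurable
  have Tm[measurable]: "T \<in> borel_measurable ?P" unfolding T_def by measurable
  have swm[measurable]: "sw \<in> ?P \<rightarrow>\<^sub>M ?P" unfolding sw_def by measurable
  have swP: "distr ?P ?P sw = ?P"
    using P.distr_pair_swap by (simp add: sw_def[abs_def] case_prod_beta')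
  have Dsw: "D (sw w) = D w" for w by (auto simp: D_def d_def sw_def add.commute)
  have fstP: "distr ?P \<Gamma> fst = \<Gamma>" by (rule \<Gamma>.distr_pair_fst)
  have "distr (distr ?P ?P sw) \<Gamma> fst = distr ?P \<Gamma> (fst \<circ> sw)"
    by (rule distr_distr) measurable
  moreover have "fst \<circ> sw = snd" by (auto simp: sw_def)
  ultimately have sndP: "distr ?P \<Gamma> snd = \<Gamma>" using fstP swP by simp
  have swint: "(\<integral>\<^sup>+ w. g (sw w) \<partial>?P) = (\<integral>\<^sup>+ w. g w \<partial>?P)" if [measurable]: "g \<in> borel_measurable ?P" for g
    by (subst (2) swP[symmetric], subst nn_integral_distr) auto
  define \<Gamma>' where "\<Gamma>' = distr ?P borel T"
  have "\<Gamma>' \<in> couplings \<mu> \<nu>"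
  proof -
    have "distr \<Gamma>' borel fst = distr ?P borel (fst \<circ> T)"
      unfolding \<Gamma>'_def by (subst distr_distr) (auto intro!: borel_measurable_continuous_onI continuous_intros)
    also have "fst \<circ> T = fst \<circ> fst" by (auto simp: T_def)
    also have "distr ?P borel (fst \<circ> fst) = distr (distr ?P \<Gamma> fst) borel fst"
      by (subst distr_distr) auto
    finally have 1: "distr \<Gamma>' borel fst = \<mu>" using m1 fstP by simp
    have 2: "distr \<Gamma>' borel snd = \<nu>"
    proof (rule measure_eqI)
      show "sets (distr \<Gamma>' borel snd) = sets \<nu>" using m2 by auto
      fix A assume "A \<in> sets (distr \<Gamma>' borel snd)"
      then have [measurable]: "A \<in> sets borel" by simp
      have "emeasure (distr \<Gamma>' borel snd) A = (\<integral>\<^sup>+ y. indicator A y \<partial>distr \<Gamma>' borel snd)"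
        by simp
      also have "\<dots> = (\<integral>\<^sup>+ z. indicator A (snd z) \<partial>\<Gamma>')"
        unfolding \<Gamma>'_def by (intro nn_integral_distr) (auto intro!: borel_measurable_continuous_onI continuous_intros)
      also have "\<dots> = (\<integral>\<^sup>+ w. indicator A (snd (T w)) \<partial>?P)"
        unfolding \<Gamma>'_def by (intro nn_integral_distr Tm measurable_compose[OF _ borel_measurable_indicator])
           (auto intro!: borel_measurable_continuous_onI continuous_intros)
      \<comment> \<open>The integral is split along \<open>D\<close>. Since \<open>D\<close> is
        invariant under \<open>sw\<close> and \<open>sw\<close> preserves the product measure, the
        exchanged part may be read with the two pairs swapped, and both parts recombine to the
        second coordinate of the first pair.\<close>
      also have "\<dots> = (\<integral>\<^sup>+ w. (if D w then indicator A (snd (snd w)) else 0) + (if D w then 0 else indicator A (snd (fst w))) \<partial>?P)"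
        by (intro nn_integral_cong) (auto simp: T_def)
      also have "\<dots> = (\<integral>\<^sup>+ w. (if D w then indicator A (snd (snd w)) else 0) \<partial>?P) + (\<integral>\<^sup>+ w. (if D w then 0 else indicator A (snd (fst w))) \<partial>?P)"
        by (intro nn_integral_add) measurable
      also have "(\<integral>\<^sup>+ w. (if D w then indicator A (snd (snd w)) else 0) \<partial>?P) = (\<integral>\<^sup>+ w. (if D (sw w) then indicator A (snd (fst (sw w))) else 0) \<partial>?P)"
        by (simp only: Dsw) (simp add: sw_def cong: if_cong)
      also have "\<dots> = (\<integral>\<^sup>+ w. (if D w then indicator A (snd (fst w)) else 0) \<partial>?P)"
        by (rule swint) measurable
      also have "\<dots> + (\<integral>\<^sup>+ w. (if D w then 0 else indicator A (snd (fst w))) \<partial>?P) =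
         (\<integral>\<^sup>+ w. (if D w then indicator A (snd (fst w)) else 0) + (if D w then 0 else indicator A (snd (fst w))) \<partial>?P)"
        by (intro nn_integral_add[symmetric]) measurable
      also have "\<dots> = (\<integral>\<^sup>+ w. indicator A (snd (fst w)) \<partial>?P)"
        by (intro nn_integral_cong) auto
      also have "\<dots> = (\<integral>\<^sup>+ z. indicator A (snd z) \<partial>distr ?P \<Gamma> fst)"
        by (intro nn_integral_distr[symmetric]) measurable
      also have "\<dots> = (\<integral>\<^sup>+ y. indicator A y \<partial>distr \<Gamma> borel snd)"
        unfolding fstP by (intro nn_integral_distr[symmetric]) measurable
      finally show "emeasure (distr \<Gamma>' borel snd) A = emeasure \<nu> A"
        using m2 by (metis \<open>A \<in> sets borel\<close> nn_integral_indicator sets_distr)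
    qed
    have "prob_space \<Gamma>'" unfolding \<Gamma>'_def by (intro P.prob_space_distr Tm)
    then show ?thesis using 1 2 by (simp add: couplings_def borel_probs_def \<Gamma>'_def)
  qed
  note le = opt[OF this]
  have cost': "(\<integral>\<^sup>+ z. ennreal (c z) \<partial>\<Gamma>') = (\<integral>\<^sup>+ w. ennreal (c (T w)) \<partial>?P)"
    unfolding \<Gamma>'_def by (intro nn_integral_distr) measurable
  have cost1: "(\<integral>\<^sup>+ w. ennreal (c (fst w)) \<partial>?P) = (\<integral>\<^sup>+ z. ennreal (c z) \<partial>\<Gamma>)"
    using nn_integral_distr[of fst ?P \<Gamma> "\<lambda>z. ennreal (c z)"] fstP by simp
  have cost2: "(\<integral>\<^sup>+ w. ennreal (c (snd w)) \<partial>?P) = (\<integral>\<^sup>+ z. ennreal (c z) \<partial>\<Gamma>)"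
    using nn_integral_distr[of snd ?P \<Gamma> "\<lambda>z. ennreal (c z)"] sndP by simp
  \<comment> \<open>\<open>?g\<close> is the total cost of the two pairs after the exchange. The
    integrals of \<open>?f\<close> and \<open>?g\<close> are twice the costs of
    \<open>\<Gamma>\<close> and \<open>\<Gamma>'\<close>, while \<open>?g\<close> is below
    \<open>?f\<close> pointwise and strictly on \<open>D\<close>; optimality therefore makes
    \<open>D\<close> null.\<close>
  let ?f = "\<lambda>w. ennreal (c (fst w) + c (snd w))" and ?g = "\<lambda>w. ennreal (c (T w) + c (T (sw w)))"
  have Tsum: "c (T w) + c (T (sw w)) = (if D w then d w else c (fst w) + c (snd w))" for w
    unfolding T_def Dsw by (auto simp: sw_def d_def)
  have "(\<integral>\<^sup>+ w. ?f w \<partial>?P) = 2 * (\<integral>\<^sup>+ z. ennreal (c z) \<partial>\<Gamma>)"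
    using c0 by (simp add: nn_integral_add cost1 cost2 mult_2)
  moreover have "(\<integral>\<^sup>+ w. ?g w \<partial>?P) = 2 * (\<integral>\<^sup>+ z. ennreal (c z) \<partial>\<Gamma>')"
    using c0 swint[of "\<lambda>w. ennreal (c (T w))"] by (simp add: nn_integral_add cost' mult_2)
  ultimately have le2: "(\<integral>\<^sup>+ w. ?f w \<partial>?P) \<le> (\<integral>\<^sup>+ w. ?g w \<partial>?P)" and fin2: "(\<integral>\<^sup>+ w. ?f w \<partial>?P) < \<infinity>"
    using le fin by (auto intro: mult_left_mono simp: ennreal_mult_less_top)
  have gf: "?g w \<le> ?f w" for w
    unfolding Tsum by (intro ennreal_leI) (auto simp: D_def)
  have "(\<integral>\<^sup>+ w. ?g w \<partial>?P) \<le> (\<integral>\<^sup>+ w. ?f w \<partial>?P)" using gf by (intro nn_integral_mono)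
  with fin2 have "(\<integral>\<^sup>+ w. ?f w - ?g w \<partial>?P) = (\<integral>\<^sup>+ w. ?f w \<partial>?P) - (\<integral>\<^sup>+ w. ?g w \<partial>?P)"
    using gf by (intro nn_integral_diff) auto
  also have "\<dots> = 0" using le2 fin2 by (intro diff_eq_0_ennreal) simp_all
  finally have int0: "(\<integral>\<^sup>+ w. ?f w - ?g w \<partial>?P) = 0" .
  have "(\<lambda>w. ?f w - ?g w) \<in> borel_measurable ?P" by measurable
  then have "AE w in ?P. ?f w - ?g w = 0"
    using int0 by (simp only: nn_integral_0_iff_AE)
  then show ?thesis
  proof (rule AE_mp, intro AE_I2 impI)
    fix w assume "?f w - ?g w = 0"
    then have "c (fst w) + c (snd w) \<le> c (T w) + c (T (sw w))"
      using c0 by (simp add: ennreal_minus ennreal_eq_0_iff del: ennreal_plus)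
    then have "\<not> D w" unfolding Tsum by (auto simp: D_def split: if_splits)
    then show "c (fst w) + c (snd w) \<le> c (fst (fst w), snd (snd w)) + c (fst (snd w), snd (fst w))"
      by (simp add: D_def d_def)
  qed
qed

text \<open>\<open>S\<close> is the support of \<open>M\<close>, of full measure because the open
  null sets have a countable subfamily with the same union. Two points of \<open>S\<close> violating
  \<open>Q\<close> would have neighbourhoods \<open>U\<close> and \<open>V\<close> with
  \<open>U \<times> V\<close> null, although both factors have positive measure.\<close>

lemma closed_full_measure_AE_pair:
  fixes M :: "'a::second_countable_topology measure"
  assumes M: "M \<in> borel_probs" and AE: "AE w in M \<Otimes>\<^sub>M M. Q w" and cl: "closed {w. Q w}"
  obtains S where "closed S" "emeasure M (- S) = 0" "\<And>z w. z \<in> S \<Longrightarrow> w \<in> S \<Longrightarrow> Q (z, w)"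
proof -
  have sM[measurable_cong]: "sets M = sets borel" and pM: "prob_space M" using M by (auto simp: borel_probs_def)
  interpret M: prob_space M by fact
  let ?F = "{U. open U \<and> emeasure M U = 0}"
  obtain F' where F': "F' \<subseteq> ?F" "countable F'" "\<Union>F' = \<Union>?F"
    using Lindelof[of ?F] by auto
  have "(\<Union>U\<in>F'. U) \<in> null_sets M"
    using F' sM by (intro null_sets_UN') (auto simp: null_sets_def)
  then have null: "emeasure M (\<Union>?F) = 0" using F'(3) by auto
  show ?thesis
  proof (rule that[of "- \<Union>?F"])
    show "closed (- \<Union>?F)" by (intro closed_Compl open_Union) auto
    show "emeasure M (- (- \<Union>?F)) = 0" using null by simp
    fix z w assume zw: "z \<in> - \<Union>?F" "w \<in> - \<Union>?F"
    show "Q (z, w)"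
    proof (rule ccontr)
      assume nQ: "\<not> Q (z, w)"
      have op: "open (- {w. Q w})" using cl by auto
      then obtain U V where UV: "open U" "open V" "z \<in> U" "w \<in> V" "U \<times> V \<subseteq> - {w. Q w}"
        using open_prod_elim[OF op, of "(z, w)"] nQ by (metis (mono_tags) ComplI mem_Collect_eq mem_Sigma_iff)
      have "AE w in M \<Otimes>\<^sub>M M. w \<notin> U \<times> V"
        using AE by (rule AE_mp) (use UV(5) in \<open>auto intro!: AE_I2\<close>)
      then have "emeasure (M \<Otimes>\<^sub>M M) (U \<times> V) = 0"
        using UV sM by (subst (asm) AE_iff_measurable[where N = "U \<times> V"])
          (auto simp: sets_eq_imp_space_eq[OF sM] space_pair_measure)
      then have "emeasure M U * emeasure M V = 0"
        using UV sM by (subst (asm) M.emeasure_pair_measure_Times) auto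
      moreover have "emeasure M U \<noteq> 0" "emeasure M V \<noteq> 0"
        using zw UV by auto
      ultimately show False by simp
    qed
  qed
qed

section \<open>Monotone sets are graphs almost everywhere\<close>

text \<open>Young's inequality for \<open>r powr (p - 1)\<close> and \<open>s\<close> with the
  conjugate exponents \<open>p / (p - 1)\<close> and \<open>p\<close>; this includes the case
  \<open>r = 0\<close>.\<close>

lemma powr_tangent_le:
  fixes p r s :: real
  assumes "p > 1" "r \<ge> 0" "s \<ge> 0"
  shows "r powr p + p * r powr (p - 1) * (s - r) \<le> s powr p"
proof -
  have eq: "r powr (p - 1) * r = r powr p"
    using assms by (cases "r = 0") (auto simp: powr_diff)
  have "r powr (p - 1) * s \<le> (r powr (p - 1)) powr (p / (p - 1)) / (p / (p - 1)) + s powr p / p"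
    using assms by (intro Youngs_inequality) (auto simp: field_simps)
  also have "(r powr (p - 1)) powr (p / (p - 1)) = r powr p"
    using assms by (simp add: powr_powr)
  finally have "p * (r powr (p - 1) * s) \<le> p * (r powr p / (p / (p - 1)) + s powr p / p)"
    using assms by (intro mult_left_mono) auto
  also have "\<dots> = (p - 1) * r powr p + s powr p" using assms by (simp add: field_simps)
  finally show ?thesis using eq by (simp add: algebra_simps)
qed

text \<open>The gradient of \<open>norm z powr p / p\<close>, also at the origin, where \<open>sgn\<close> vanishes.\<close>

definition norm_powr_grad :: "real \<Rightarrow> 'b::euclidean_space \<Rightarrow> 'b" where
  "norm_powr_grad p z = norm z powr (p - 1) *\<^sub>R sgn z"

text \<open>Cauchy-Schwarz reduces the claim to the scalar tangent inequality for the two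
  norms.\<close>

lemma norm_powr_tangent_le:
  assumes p: "p > 1"
  shows "norm a powr p + p * (norm_powr_grad p a \<bullet> (b - a)) \<le> norm b powr p"
proof -
  have "sgn a \<bullet> (b - a) \<le> norm b - norm a"
  proof (cases "a = 0")
    case False
    have "a \<bullet> b \<le> norm a * norm b" by (rule norm_cauchy_schwarz)
    then show ?thesis using False
      by (simp add: sgn_div_norm inner_diff_right field_simps power2_norm_eq_inner[symmetric] power2_eq_square)
  qed simp
  then have "p * (norm a powr (p - 1) * (sgn a \<bullet> (b - a))) \<le> p * (norm a powr (p - 1) * (norm b - norm a))"
    using p by (intro mult_left_mono) auto
  then show ?thesis
    using powr_tangent_le[OF p, of "norm a" "norm b"] by (simp add: norm_powr_grad_def algebra_simps)
qed

text \<open>For unequal norms, strictness comes from the strict growth of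
  \<open>r powr (p - 1)\<close>. For equal norms \<open>r\<close>, the product is a positive
  multiple of the squared distance of \<open>a\<close> and \<open>b\<close>.\<close>

lemma norm_powr_grad_strict_mono:
  assumes p: "p > 1" and ab: "a \<noteq> b"
  shows "(norm_powr_grad p a - norm_powr_grad p b) \<bullet> (a - b) > 0"
proof -
  let ?r = "norm a" and ?s = "norm b" and ?q = "\<lambda>r::real. r powr (p - 1)"
  have sg: "sgn x \<bullet> x = norm x" for x :: 'a
    by (cases "x = 0") (auto simp: sgn_div_norm power2_norm_eq_inner[symmetric] power2_eq_square)
  have cs: "sgn x \<bullet> y \<le> norm y" for x y :: 'a
    using norm_cauchy_schwarz[of "sgn x" y] by (cases "x = 0") (auto simp: norm_sgn)
  have eq: "(norm_powr_grad p a - norm_powr_grad p b) \<bullet> (a - b) =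
     ?q ?r * (?r - sgn a \<bullet> b) + ?q ?s * (?s - sgn b \<bullet> a)"
    by (simp add: norm_powr_grad_def algebra_simps sg)
  show ?thesis
  proof (cases "?r = ?s")
    case True
    then have r: "?r > 0" using ab by auto
    have "sgn a \<bullet> b = (a \<bullet> b) / ?r" "sgn b \<bullet> a = (a \<bullet> b) / ?r"
      using True by (auto simp: sgn_div_norm inner_commute divide_inverse)
    then have "(norm_powr_grad p a - norm_powr_grad p b) \<bullet> (a - b) = ?q ?r * (2 * ?r - 2 * (a \<bullet> b) / ?r)"
      unfolding eq using True by (simp add: algebra_simps)
    also have "2 * ?r - 2 * (a \<bullet> b) / ?r = ((a - b) \<bullet> (a - b)) / ?r"
    proof -
      have "a \<bullet> a = ?r * ?r" "b \<bullet> b = ?r * ?r"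
        using True by (auto simp: power2_norm_eq_inner[symmetric] power2_eq_square)
      then show ?thesis using r by (simp add: inner_diff_left inner_diff_right inner_commute field_simps)
    qed
    finally show ?thesis using r ab by simp
  next
    case False
    have "0 < (?q ?r - ?q ?s) * (?r - ?s)"
      using False p by (auto simp: neq_iff zero_less_mult_iff intro!: powr_less_mono2)
    also have "\<dots> = ?q ?r * (?r - ?s) + ?q ?s * (?s - ?r)" by (simp add: algebra_simps)
    also have "\<dots> \<le> ?q ?r * (?r - sgn a \<bullet> b) + ?q ?s * (?s - sgn b \<bullet> a)"
      using cs[of a b] cs[of b a] by (intro add_mono mult_left_mono) auto
    finally show ?thesis unfolding eq .
  qed
qed

text \<open>At the origin \<open>sgn\<close> jumps, but the factor
  \<open>norm x powr (p - 1)\<close> tends to 0 because \<open>p > 1\<close>.\<close>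

lemma continuous_on_norm_powr_grad:
  assumes p: "p > 1"
  shows "continuous_on UNIV (norm_powr_grad p :: 'b::euclidean_space \<Rightarrow> 'b)"
proof -
  have "isCont (norm_powr_grad p) z" for z :: 'b
  proof (cases "z = 0")
    case False
    then show ?thesis unfolding norm_powr_grad_def
      by (intro continuous_intros isCont_sgn) auto
  next
    case True
    have "((\<lambda>x. norm x powr (p - 1)) \<longlongrightarrow> 0 powr (p - 1)) (at (0::'b))"
      using p by (intro tendsto_powr' tendsto_const tendsto_norm_zero tendsto_ident_at) auto
    then have "((\<lambda>x. norm x powr (p - 1)) \<longlongrightarrow> 0) (at (0::'b))" by simp
    then have "(norm_powr_grad p \<longlongrightarrow> (0::'b)) (at 0)"
      by (rule Lim_null_comparison[rotated])
        (auto simp: norm_powr_grad_def norm_sgn intro!: always_eventually)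
    then show ?thesis using True by (simp add: isCont_def norm_powr_grad_def)
  qed
  then show ?thesis by (simp add: continuous_on_eq_continuous_at)
qed

section \<open>Lebesgue null sets obtained from monotonicity\<close>

lemma emeasure_lborel_0_if_meets_lines_once:
  fixes P :: "'b::euclidean_space set"
  assumes P[measurable]: "P \<in> sets borel" and bd: "bounded P"
    and once: "\<And>y t. y \<in> P \<Longrightarrow> y + t *\<^sub>R v \<in> P \<Longrightarrow> t > 0 \<Longrightarrow> False"
  shows "emeasure lborel P = 0"
proof -
  obtain r where r: "P \<subseteq> ball 0 r" using bounded_subset_ballD[OF bd, of 0] by auto
  text \<open>Infinitely many translates of \<open>P\<close> are disjoint and lie in one ball.\<close>
  define Q where "Q k = (\<lambda>y. (1 / real (Suc k)) *\<^sub>R v + y) ` P" for k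
  have Q: "Q k = (\<lambda>y. - ((1 / real (Suc k)) *\<^sub>R v) + y) -` P" for k
    by (force simp: Q_def image_iff)
  have Qm[measurable]: "Q k \<in> sets borel" for k
    unfolding Q by (rule measurable_sets_borel[OF _ P]) measurable
  have Qe: "emeasure lborel (Q k) = emeasure lborel P" for k
    unfolding Q
    using emeasure_distr[of "(+) (- ((1 / real (Suc k)) *\<^sub>R v))" lborel borel P]
    by (simp add: lborel_distr_plus)
  have disj: "disjoint_family Q"
    unfolding disjoint_family_on_def
  proof (intro ballI impI)
    have *: "Q j \<inter> Q k = {}" if "j < k" for j k
    proof (rule ccontr)
      assume "Q j \<inter> Q k \<noteq> {}"
      then obtain y z where yz: "y \<in> P" "z \<in> P" "(1 / real (Suc j)) *\<^sub>R v + y = (1 / real (Suc k)) *\<^sub>R v + z"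
        by (auto simp: Q_def)
      then have "z = y + (1 / real (Suc j) - 1 / real (Suc k)) *\<^sub>R v"
        by (simp add: algebra_simps)
      moreover have "1 / real (Suc j) - 1 / real (Suc k) > 0"
        using that by (simp add: frac_less2)
      ultimately show False using once yz by blast
    qed
    fix j k :: nat assume "j \<noteq> k"
    then show "Q j \<inter> Q k = {}" using *[of j k] *[of k j] by (cases "j < k") auto
  qed
  have sub: "Q k \<subseteq> ball 0 (r + norm v)" for k
  proof
    fix x assume "x \<in> Q k"
    then obtain y where y: "y \<in> P" "x = (1 / real (Suc k)) *\<^sub>R v + y" by (auto simp: Q_def)
    have "norm x \<le> norm ((1 / real (Suc k)) *\<^sub>R v) + norm y" unfolding y(2) by (rule norm_triangle_ineq)
    also have "norm ((1 / real (Suc k)) *\<^sub>R v) \<le> norm v"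
      by (simp add: field_simps)
    finally show "x \<in> ball 0 (r + norm v)" using r y(1) by (auto simp: subset_iff)
  qed
  have "(\<Sum>k. emeasure lborel P) = (\<Sum>k. emeasure lborel (Q k))" by (simp add: Qe)
  also have "\<dots> = emeasure lborel (\<Union>k. Q k)"
    using disj by (intro suminf_emeasure) auto
  also have "\<dots> \<le> emeasure lborel (ball (0::'b) (r + norm v))"
    by (intro emeasure_mono UN_least sub) auto
  also have "\<dots> < \<infinity>" by (intro emeasure_bounded_finite) auto
  finally have fin: "(\<Sum>k::nat. emeasure lborel P) < \<infinity>" .
  \<comment> \<open>Every multiple of the measure of \<open>P\<close> stays below one finite number,
    so this measure is 0.\<close>
  have bound: "of_nat n * emeasure lborel P \<le> (\<Sum>k::nat. emeasure lborel P)" for n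
    using sum_le_suminf[of "\<lambda>_::nat. emeasure lborel P" "{..<n}"] by simp
  obtain B where B: "(\<Sum>k::nat. emeasure lborel P) = ennreal B" "B \<ge> 0"
    using fin by (cases "\<Sum>k::nat. emeasure lborel P") auto
  obtain x where x: "emeasure lborel P = ennreal x" "x \<ge> 0"
    using bound[of 1] fin by (cases "emeasure lborel P") (auto simp: top_unique)
  have "real n * x \<le> B" for n
    using bound[of n] x(2) B(2) unfolding B(1) unfolding x(1)
    by (simp add: ennreal_of_nat_eq_real_of_nat ennreal_mult[symmetric])
  then have "x \<le> 0" using reals_Archimedean3[of x] by (meson not_less)
  then show ?thesis using x by simp
qed

text \<open>Continuous images of Borel sets need not be Borel, but \<open>S \<inter> U\<close> is a
  countable union of compact sets, and so is its image.\<close>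

lemma borel_continuous_image_closed_Int_open:
  fixes f :: "'a::euclidean_space \<Rightarrow> 'b::t2_space"
  assumes f: "continuous_on UNIV f" and S: "closed S" and U: "open U"
  shows "f ` (S \<inter> U) \<in> sets borel"
proof -
  obtain C :: "nat \<Rightarrow> 'a set" where C: "\<And>n. compact (C n)" "\<Union>(range C) = U"
    using open_Union_compact_subsets[OF U] by metis
  have "f ` (S \<inter> U) = (\<Union>n. f ` (S \<inter> C n))" using C(2) by blast
  moreover have "compact (f ` (S \<inter> C n))" for n
    using closed_Int_compact[OF S C(1)] continuous_on_subset[OF f]
    by (intro compact_continuous_image) auto
  ultimately show ?thesis by (auto intro!: sets.countable_UN intro: borel_compact)
qed

text \<open>The triples \<open>(x, x', y)\<close> with distinct \<open>x\<close> and
  \<open>x'\<close> are covered by countably many \<open>good\<close> boxes. Within one box, the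
  points \<open>y\<close> that arise from \<open>S\<close> meet each line in the direction
  \<open>v\<close> at most once, so they form a null set.\<close>

lemma multivalued_fibres_null:
  fixes S :: "('b::euclidean_space \<times> 'b) set"
  assumes p: "p > 1" and S: "closed S"
    and mono: "\<And>x y x' y'. (x, y) \<in> S \<Longrightarrow> (x', y') \<in> S \<Longrightarrow>
      norm (x - y) powr p + norm (x' - y') powr p \<le> norm (x - y') powr p + norm (x' - y) powr p"
  shows "{y. \<exists>x x'. x \<noteq> x' \<and> (x, y) \<in> S \<and> (x', y) \<in> S} \<in> null_sets lborel"
proof -
  let ?q = "norm_powr_grad p :: 'b \<Rightarrow> 'b"
  text \<open>Near a triple \<open>(x, x', y)\<close> with \<open>x \<noteq> x'\<close> the two gradients differ strictly in a fixed
    direction \<open>v\<close>; two fibres over points that differ by a positive multiple of \<open>v\<close> would then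
    violate the monotonicity.\<close>
  define good where "good W \<longleftrightarrow> (\<exists>A1 A2 A3 v. open A1 \<and> open A2 \<and> open A3 \<and> bounded A3 \<and> W = A1 \<times> A2 \<times> A3 \<and>
     (\<forall>a1\<in>A1. \<forall>a2\<in>A2. \<forall>y\<in>A3. \<forall>y'\<in>A3. (?q (a1 - y') - ?q (a2 - y)) \<bullet> v > 0))" for W
  define proj where "proj W = (\<lambda>z. snd (snd z)) ` ({z. (fst z, snd (snd z)) \<in> S \<and> (fst (snd z), snd (snd z)) \<in> S} \<inter> W)"
    for W
  have cover: "\<exists>W. good W \<and> (x1, x2, y) \<in> W" if "x1 \<noteq> x2" for x1 x2 y
  proof -
    define v where "v = x1 - x2"
    \<comment> \<open>The two occurrences of \<open>y\<close> become separate variables because the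
      fibres compared later lie over different points. Positivity at \<open>(x1, x2, y, y)\<close>
      is strict monotonicity of the gradient, as \<open>x1 - y\<close> and \<open>x2 - y\<close>
      differ by \<open>v\<close>.\<close>
    let ?g = "\<lambda>z::'b \<times> 'b \<times> 'b \<times> 'b. (?q (fst z - snd (snd (snd z))) - ?q (fst (snd z) - fst (snd (snd z)))) \<bullet> v"
    have cont: "continuous_on UNIV ?g"
      by (intro continuous_on_inner continuous_on_diff continuous_on_const
        continuous_on_compose2[OF continuous_on_norm_powr_grad[OF p]] continuous_on_fst continuous_on_snd continuous_on_id) auto
    have "open {z. ?g z > 0}"
      by (rule open_Collect_less[OF continuous_on_const cont])
    moreover have "(x1, x2, y, y) \<in> {z. ?g z > 0}"
      using norm_powr_grad_strict_mono[OF p, of "x1 - y" "x2 - y"] that by (simp add: v_def)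
    ultimately obtain A1 B where "open A1" "open B" "(x1, x2, y, y) \<in> A1 \<times> B" "A1 \<times> B \<subseteq> {z. ?g z > 0}"
      by (rule open_prod_elim)
    then have A1: "open A1" "x1 \<in> A1" "open B" "(x2, y, y) \<in> B" "A1 \<times> B \<subseteq> {z. ?g z > 0}" by auto
    obtain A2 C where "open A2" "open C" "(x2, y, y) \<in> A2 \<times> C" "A2 \<times> C \<subseteq> B"
      using A1(3,4) by (rule open_prod_elim)
    then have A2: "open A2" "x2 \<in> A2" "open C" "(y, y) \<in> C" "A2 \<times> C \<subseteq> B" by auto
    obtain Y Y' where "open Y" "open Y'" "(y, y) \<in> Y \<times> Y'" "Y \<times> Y' \<subseteq> C"
      using A2(3,4) by (rule open_prod_elim)
    then have Y: "open Y" "y \<in> Y" "open Y'" "y \<in> Y'" "Y \<times> Y' \<subseteq> C" by auto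
    \<comment> \<open>The ball makes the projection of the box bounded, as the argument with
      translates requires.\<close>
    let ?A3 = "Y \<inter> Y' \<inter> ball y 1"
    have "?g (a1, a2, u, u') > 0" if "a1 \<in> A1" "a2 \<in> A2" "u \<in> ?A3" "u' \<in> ?A3" for a1 a2 u u'
      using that A1(5) A2(5) Y(5) by blast
    then have "good (A1 \<times> A2 \<times> ?A3)"
      unfolding good_def using A1 A2 Y
      by (intro exI[of _ A1] exI[of _ A2] exI[of _ ?A3] exI[of _ v]) (auto intro: bounded_subset[OF bounded_ball])
    then show ?thesis using A1 A2 Y by (intro exI[of _ "A1 \<times> A2 \<times> ?A3"]) auto
  qed
  have opengood: "open W" if "W \<in> {W. good W}" for W
    using that unfolding good_def by (auto intro!: open_Times)
  obtain F where F: "F \<subseteq> {W. good W}" "countable F" "\<Union>F = \<Union>{W. good W}"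
    using Lindelof[OF opengood] by blast
  have null: "proj W \<in> null_sets lborel" if good: "good W" for W
  proof -
    obtain A1 A2 A3 v where W: "open A1" "open A2" "open A3" "bounded A3" "W = A1 \<times> A2 \<times> A3"
      and "\<forall>a1\<in>A1. \<forall>a2\<in>A2. \<forall>y\<in>A3. \<forall>y'\<in>A3. (?q (a1 - y') - ?q (a2 - y)) \<bullet> v > 0"
      using good unfolding good_def by blast
    then have pos: "(?q (a1 - y') - ?q (a2 - y)) \<bullet> v > 0" if "a1 \<in> A1" "a2 \<in> A2" "y \<in> A3" "y' \<in> A3" for a1 a2 y y'
      using that by blast
    have cl: "closed {z::'b \<times> 'b \<times> 'b. (fst z, snd (snd z)) \<in> S \<and> (fst (snd z), snd (snd z)) \<in> S}"
    proof -
      have "closed ((\<lambda>z::'b \<times> 'b \<times> 'b. (fst z, snd (snd z))) -` S)" 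
        "closed ((\<lambda>z::'b \<times> 'b \<times> 'b. (fst (snd z), snd (snd z))) -` S)"
        by (intro closed_vimage[OF S] continuous_intros)+
      then show ?thesis by (auto simp: vimage_def Collect_conj_eq intro!: closed_Int)
    qed
    have meas: "proj W \<in> sets borel"
      unfolding proj_def using good opengood
      by (intro borel_continuous_image_closed_Int_open cl continuous_intros) auto
    moreover have "emeasure lborel (proj W) = 0"
    proof (rule emeasure_lborel_0_if_meets_lines_once[OF meas])
      show "bounded (proj W)" by (rule bounded_subset[OF W(4)]) (auto simp: proj_def W(5))
      fix y t assume y: "y \<in> proj W" "y + t *\<^sub>R v \<in> proj W" and t: "t > 0"
      let ?y = "y + t *\<^sub>R v"
      obtain x1 where x1: "x1 \<in> A1" "(x1, y) \<in> S" "y \<in> A3" using y(1) by (auto simp: proj_def W(5))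
      obtain x2 where x2: "x2 \<in> A2" "(x2, ?y) \<in> S" "?y \<in> A3" using y(2) by (auto simp: proj_def W(5))
      \<comment> \<open>Adding the two tangent inequalities below shows that exchanging
        \<open>y\<close> and \<open>?y\<close> lowers the total cost by at least this amount,
        against \<open>mono\<close>.\<close>
      have "0 < p * (t * ((?q (x1 - ?y) - ?q (x2 - y)) \<bullet> v))"
        using pos[OF x1(1) x2(1) x1(3) x2(3)] p t by simp
      moreover have "norm (x1 - ?y) powr p + p * (?q (x1 - ?y) \<bullet> (t *\<^sub>R v)) \<le> norm (x1 - y) powr p"
        using norm_powr_tangent_le[OF p, of "x1 - ?y" "x1 - y"] by simp
      moreover have "norm (x2 - y) powr p - p * (?q (x2 - y) \<bullet> (t *\<^sub>R v)) \<le> norm (x2 - ?y) powr p"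
        using norm_powr_tangent_le[OF p, of "x2 - y" "x2 - ?y"] by (simp add: inner_minus_right)
      ultimately show False
        using mono[OF x1(2) x2(2)] by (simp add: inner_diff_left algebra_simps)
    qed
    ultimately show ?thesis by (auto simp: null_sets_def)
  qed
  have "{y. \<exists>x x'. x \<noteq> x' \<and> (x, y) \<in> S \<and> (x', y) \<in> S} = (\<Union>W\<in>F. proj W)"
  proof (intro equalityI subsetI)
    fix y assume "y \<in> {y. \<exists>x x'. x \<noteq> x' \<and> (x, y) \<in> S \<and> (x', y) \<in> S}"
    then obtain x x' where x: "x \<noteq> x'" "(x, y) \<in> S" "(x', y) \<in> S" by auto
    then have "(x, x', y) \<in> \<Union>F" using cover[of x x' y] unfolding F(3) by auto
    then show "y \<in> (\<Union>W\<in>F. proj W)" using x unfolding proj_def by force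
  next
    fix y assume "y \<in> (\<Union>W\<in>F. proj W)"
    then obtain W x x' where x: "W \<in> F" "(x, x', y) \<in> W" "(x, y) \<in> S" "(x', y) \<in> S"
      by (auto simp: proj_def)
    have "good W" using F(1) x(1) by auto
    \<comment> \<open>A \<open>good\<close> box contains no triple with \<open>x = x'\<close>: equal
      points and equal \<open>y\<close> would give \<open>0 > 0\<close>.\<close>
    then have "x \<noteq> x'" using x(2) unfolding good_def by fastforce
    then show "y \<in> {y. \<exists>x x'. x \<noteq> x' \<and> (x, y) \<in> S \<and> (x', y) \<in> S}" using x by auto
  qed
  also have "\<dots> \<in> null_sets lborel" using F null by (intro null_sets_UN') auto
  finally show ?thesis .
qed

section \<open>Strict convexity of the transport cost\<close>

text \<open>Outside the null set, a point of \<open>S\<close> is determined by its second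
  coordinate, so it lies over \<open>F\<close> exactly when that coordinate lies in the projection
  \<open>E F\<close>. Both first marginals thus give \<open>F\<close> the
  \<open>\<nu>\<close>-measure of \<open>E F\<close> without the null set. Closed \<open>F\<close>
  suffice, and for them \<open>E F\<close> is Borel.\<close>

lemma couplings_first_marginal_eq:
  fixes \<mu>1 \<mu>2 \<nu> :: "'b::euclidean_space measure"
  assumes \<Gamma>1: "\<Gamma>1 \<in> couplings \<mu>1 \<nu>" and \<Gamma>2: "\<Gamma>2 \<in> couplings \<mu>2 \<nu>"
    and S: "closed S" "emeasure \<Gamma>1 (- S) = 0" "emeasure \<Gamma>2 (- S) = 0"
    and N: "{y. \<exists>x x'. x \<noteq> x' \<and> (x, y) \<in> S \<and> (x', y) \<in> S} \<in> null_sets \<nu>"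
  shows "\<mu>1 = \<mu>2"
proof -
  let ?N = "{y. \<exists>x x'. x \<noteq> x' \<and> (x, y) \<in> S \<and> (x', y) \<in> S}"
  define E where "E F = snd ` (S \<inter> F \<times> UNIV)" for F :: "'b set"
  have s\<nu>: "sets \<nu> = sets borel" using \<Gamma>1 by (auto simp: couplings_def)
  have Nm: "?N \<in> sets borel" using null_setsD2[OF N] s\<nu> by simp
  have Em: "E F \<in> sets borel" if "closed F" for F
  proof -
    have "closed (S \<inter> F \<times> UNIV)" using S(1) that by (intro closed_Int closed_Times) auto
    from borel_continuous_image_closed_Int_open[OF _ this open_UNIV, of snd] show ?thesis
      by (simp add: E_def continuous_on_snd)
  qed
  have key: "emeasure \<mu> F = emeasure \<nu> (E F - ?N)"
    if \<Gamma>: "\<Gamma> \<in> couplings \<mu> \<nu>" and null: "emeasure \<Gamma> (- S) = 0" and F: "closed F" for \<Gamma> \<mu> F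
  proof -
    have s\<Gamma>: "sets \<Gamma> = sets borel" using \<Gamma> by (auto simp: couplings_def borel_probs_def)
    have Fm: "F \<in> sets borel" using F by simp
    have "- S \<in> null_sets \<Gamma>" using null S(1) s\<Gamma> by (auto simp: null_sets_def)
    then have 1: "AE z in \<Gamma>. z \<notin> - S" by (rule AE_not_in)
    have "UNIV \<times> ?N \<in> null_sets \<Gamma>"
      using couplings_emeasure(2)[OF \<Gamma> Nm] N Nm s\<Gamma>
      by (simp add: null_sets_def borel_Times)
    then have 2: "AE z in \<Gamma>. z \<notin> UNIV \<times> ?N" by (rule AE_not_in)
    have "emeasure \<mu> F = emeasure \<Gamma> (F \<times> UNIV)" using couplings_emeasure(1)[OF \<Gamma> Fm] by simp
    also have "\<dots> = emeasure \<Gamma> (UNIV \<times> (E F - ?N))"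
    proof (rule emeasure_eq_AE)
      show "AE z in \<Gamma>. (z \<in> F \<times> UNIV) = (z \<in> UNIV \<times> (E F - ?N))"
        using 1 2
      proof eventually_elim
        case (elim z)
        have "fst z \<in> F" if zE: "snd z \<in> E F"
        proof -
          obtain x where x: "(x, snd z) \<in> S" "x \<in> F" using zE by (auto simp: E_def)
          have "(fst z, snd z) \<in> S" "snd z \<notin> ?N" using elim by (auto simp: mem_Times_iff)
          then have "fst z = x" using x(1) by blast
          then show ?thesis using x(2) by simp
        qed
        moreover have "snd z \<in> E F" if "fst z \<in> F"
          using that elim(1) by (force simp: E_def mem_Times_iff)
        ultimately show ?case using elim(2) by (auto simp: mem_Times_iff)
      qed
      show "F \<times> UNIV \<in> sets \<Gamma>" using Fm s\<Gamma> by (simp add: borel_Times)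
      have "E F - ?N \<in> sets borel" using Em[OF F] Nm by (rule sets.Diff)
      then show "UNIV \<times> (E F - ?N) \<in> sets \<Gamma>" using s\<Gamma> by (simp add: borel_Times)
    qed
    also have "\<dots> = emeasure \<nu> (E F - ?N)"
      using couplings_emeasure(2)[OF \<Gamma>] Em[OF F] Nm by (meson sets.Diff)
    finally show ?thesis .
  qed
  have s: "sets \<mu>1 = sets borel" "sets \<mu>2 = sets borel" using \<Gamma>1 \<Gamma>2 by (auto simp: couplings_def)
  have p: "prob_space \<Gamma>1" using \<Gamma>1 by (auto simp: couplings_def borel_probs_def)
  have "emeasure \<mu>1 UNIV = emeasure \<Gamma>1 (UNIV \<times> UNIV)"
    using couplings_emeasure(1)[OF \<Gamma>1, of UNIV] by simp
  also have "\<dots> \<noteq> \<infinity>" using p by (simp add: prob_space.finite_measure finite_measure.emeasure_finite)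
  finally have fin: "emeasure \<mu>1 UNIV \<noteq> \<infinity>" .
  show ?thesis
  proof (rule measure_eqI_generator_eq[where E = "{F. closed F}" and A = "\<lambda>_. UNIV" and \<Omega> = UNIV])
    show "emeasure \<mu>1 F = emeasure \<mu>2 F" if "F \<in> {F. closed F}" for F
      using key[OF \<Gamma>1 S(2)] key[OF \<Gamma>2 S(3)] that by auto
    show "sets \<mu>1 = sigma_sets UNIV {F. closed F}" "sets \<mu>2 = sigma_sets UNIV {F. closed F}"
      using s by (simp_all add: borel_eq_closed)
  qed (use fin in \<open>auto simp: Int_stable_def\<close>)
qed

section \<open>Midpoints of probability measures\<close>

lemma ennreal_half_plus_half: "x / 2 + x / 2 = (x :: ennreal)"
  by (cases x) (auto simp: ennreal_divide_numeral ennreal_plus[symmetric] ennreal_top_divide simp del: ennreal_plus)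

text \<open>The average of the two measures, written as a fair coin toss followed by a choice, so
  that compatibility with \<open>mixture\<close> becomes associativity of the monadic bind.\<close>

definition midpoint_measure :: "'a measure \<Rightarrow> 'a measure \<Rightarrow> 'a measure" where
  "midpoint_measure M N = measure_pmf (bernoulli_pmf (1/2)) \<bind> (\<lambda>b. if b then M else N)"

context
  fixes M N :: "'a::topological_space measure"
  assumes M: "M \<in> borel_probs" and N: "N \<in> borel_probs"
begin

lemma midpoint_kernel:
  "(\<lambda>b. if b then M else N) \<in> measure_pmf (bernoulli_pmf (1/2)) \<rightarrow>\<^sub>M subprob_algebra borel"
  using M N by (auto simp: borel_probs_def space_subprob_algebra intro: prob_space_imp_subprob_space split: if_splits)

lemma midpoint_measure_in_borel_probs: "midpoint_measure M N \<in> borel_probs"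
proof -
  have "prob_space (midpoint_measure M N)"
    unfolding midpoint_measure_def using M N
    by (intro prob_space.prob_space_bind[OF prob_space_measure_pmf _ midpoint_kernel])
      (auto simp: borel_probs_def)
  moreover have "sets (midpoint_measure M N) = sets borel"
    unfolding midpoint_measure_def using M N by (intro sets_bind) (auto simp: borel_probs_def)
  ultimately show ?thesis by (simp add: borel_probs_def)
qed

lemma nn_integral_midpoint_measure:
  assumes "f \<in> borel_measurable borel"
  shows "(\<integral>\<^sup>+ x. f x \<partial>midpoint_measure M N) = (\<integral>\<^sup>+ x. f x \<partial>M) / 2 + (\<integral>\<^sup>+ x. f x \<partial>N) / 2"
proof -
  have half: "ennreal (1 / 2) = inverse 2"
    using inverse_ennreal[of 2] by (simp add: inverse_eq_divide)
  have "(\<integral>\<^sup>+ x. f x \<partial>midpoint_measure M N) =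
      (\<integral>\<^sup>+ b. (\<integral>\<^sup>+ x. f x \<partial>(if b then M else N)) \<partial>measure_pmf (bernoulli_pmf (1/2)))"
    unfolding midpoint_measure_def by (rule nn_integral_bind[OF assms midpoint_kernel])
  also have "\<dots> = (\<integral>\<^sup>+ x. f x \<partial>M) / 2 + (\<integral>\<^sup>+ x. f x \<partial>N) / 2"
    by (simp add: half divide_ennreal_def)
  finally show ?thesis .
qed

lemma emeasure_midpoint_measure:
  assumes "A \<in> sets borel"
  shows "emeasure (midpoint_measure M N) A = emeasure M A / 2 + emeasure N A / 2"
proof -
  have "sets (midpoint_measure M N) = sets borel" "sets M = sets borel" "sets N = sets borel"
    using M N midpoint_measure_in_borel_probs by (auto simp: borel_probs_def)
  then show ?thesis
    using nn_integral_midpoint_measure[of "indicator A"] assms by simp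
qed

lemma mixture_midpoint_measure:
  assumes "markov_kernel \<rho>"
  shows "mixture \<rho> (midpoint_measure M N) = midpoint_measure (mixture \<rho> M) (mixture \<rho> N)"
proof -
  have "\<rho> \<in> borel \<rightarrow>\<^sub>M subprob_algebra borel"
    using assms by (simp add: markov_kernel_iff measurable_prob_algebraD)
  then show ?thesis
    unfolding mixture_def midpoint_measure_def
    by (subst bind_assoc[OF midpoint_kernel]) (auto intro!: arg_cong2[where f = bind])
qed

end

text \<open>Strict convexity in contrapositive form: \<open>le\<close> says that the midpoint
  coupling, whose cost is the average of the two optimal costs, is itself optimal, so its support is
  monotone.\<close>

lemma wasserstein_pow_strict_convex:
  fixes \<mu>1 \<mu>2 \<nu> :: "'b::euclidean_space measure"
  assumes p: "p > 1" and \<nu>: "\<nu> \<in> borel_probs" "absolutely_continuous lborel \<nu>"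
    and \<mu>: "\<mu>1 \<in> borel_probs" "\<mu>2 \<in> borel_probs"
    and fin: "wasserstein_pow p \<mu>1 \<nu> < \<infinity>" "wasserstein_pow p \<mu>2 \<nu> < \<infinity>"
    and le: "wasserstein_pow p \<mu>1 \<nu> / 2 + wasserstein_pow p \<mu>2 \<nu> / 2
      \<le> wasserstein_pow p (midpoint_measure \<mu>1 \<mu>2) \<nu>"
  shows "\<mu>1 = \<mu>2"
proof -
  let ?c = "\<lambda>z::'b \<times> 'b. norm (fst z - snd z) powr p"
  have p0: "p > 0" using p by simp
  have cc: "continuous_on UNIV ?c" using p by (intro continuous_on_powr' continuous_intros) auto
  then have cm: "?c \<in> borel_measurable borel" by (rule borel_measurable_continuous_onI)
  obtain \<Gamma>1 where \<Gamma>1: "\<Gamma>1 \<in> couplings \<mu>1 \<nu>" "(\<integral>\<^sup>+ z. ennreal (?c z) \<partial>\<Gamma>1) = wasserstein_pow p \<mu>1 \<nu>"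
    using optimal_coupling_exists[OF p0 \<mu>(1) \<nu>(1) fin(1)] by blast
  obtain \<Gamma>2 where \<Gamma>2: "\<Gamma>2 \<in> couplings \<mu>2 \<nu>" "(\<integral>\<^sup>+ z. ennreal (?c z) \<partial>\<Gamma>2) = wasserstein_pow p \<mu>2 \<nu>"
    using optimal_coupling_exists[OF p0 \<mu>(2) \<nu>(1) fin(2)] by blast
  have bp: "\<Gamma>1 \<in> borel_probs" "\<Gamma>2 \<in> borel_probs" using \<Gamma>1 \<Gamma>2 by (auto simp: couplings_def)
  define \<Gamma> where "\<Gamma> = midpoint_measure \<Gamma>1 \<Gamma>2"
  let ?\<mu> = "midpoint_measure \<mu>1 \<mu>2"
  have \<Gamma>p: "\<Gamma> \<in> borel_probs" unfolding \<Gamma>_def by (rule midpoint_measure_in_borel_probs[OF bp])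
  have \<Gamma>: "\<Gamma> \<in> couplings ?\<mu> \<nu>"
  proof (rule couplingsI[OF \<Gamma>p])
    show "sets ?\<mu> = sets borel" "sets \<nu> = sets borel"
      using midpoint_measure_in_borel_probs[OF \<mu>] \<nu>(1) by (auto simp: borel_probs_def)
    show "emeasure \<Gamma> (A \<times> UNIV) = emeasure ?\<mu> A" if A: "A \<in> sets borel" for A
      unfolding \<Gamma>_def emeasure_midpoint_measure[OF \<mu> A]
      using couplings_emeasure(1)[OF \<Gamma>1(1) A] couplings_emeasure(1)[OF \<Gamma>2(1) A] A
      by (subst emeasure_midpoint_measure[OF bp]) (auto simp: borel_Times)
    show "emeasure \<Gamma> (UNIV \<times> B) = emeasure \<nu> B" if B: "B \<in> sets borel" for B
      unfolding \<Gamma>_def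
      using couplings_emeasure(2)[OF \<Gamma>1(1) B] couplings_emeasure(2)[OF \<Gamma>2(1) B] B
      by (subst emeasure_midpoint_measure[OF bp]) (auto simp: borel_Times ennreal_half_plus_half)
  qed
  have cost: "(\<integral>\<^sup>+ z. ennreal (?c z) \<partial>\<Gamma>) = wasserstein_pow p \<mu>1 \<nu> / 2 + wasserstein_pow p \<mu>2 \<nu> / 2"
    unfolding \<Gamma>_def using cm by (subst nn_integral_midpoint_measure[OF bp]) (auto simp: \<Gamma>1(2) \<Gamma>2(2))
  have "AE w in \<Gamma> \<Otimes>\<^sub>M \<Gamma>. ?c (fst w) + ?c (snd w) \<le> ?c (fst (fst w), snd (snd w)) + ?c (fst (snd w), snd (fst w))"
  proof (rule optimal_coupling_swap[OF \<Gamma> cm])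
    show "(\<integral>\<^sup>+ z. ennreal (?c z) \<partial>\<Gamma>) < \<infinity>"
      unfolding cost using fin by (auto simp: ennreal_divide_eq_top_iff less_top[symmetric])
    show "(\<integral>\<^sup>+ z. ennreal (?c z) \<partial>\<Gamma>) \<le> (\<integral>\<^sup>+ z. ennreal (?c z) \<partial>\<Gamma>')" if "\<Gamma>' \<in> couplings ?\<mu> \<nu>" for \<Gamma>'
    proof -
      have "(\<integral>\<^sup>+ z. ennreal (?c z) \<partial>\<Gamma>) \<le> wasserstein_pow p ?\<mu> \<nu>" unfolding cost by (rule le)
      also have "\<dots> \<le> (\<integral>\<^sup>+ z. ennreal (?c z) \<partial>\<Gamma>')"
        unfolding wasserstein_pow_def using that by (rule INF_lower)
      finally show ?thesis .
    qed
  qed auto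
  moreover have "closed {w. ?c (fst w) + ?c (snd w) \<le> ?c (fst (fst w), snd (snd w)) + ?c (fst (snd w), snd (fst w))}"
    by (intro closed_Collect_le continuous_on_add continuous_on_compose2[OF cc] continuous_intros) auto
  ultimately obtain S where S: "closed S" "emeasure \<Gamma> (- S) = 0"
    and mono: "\<And>z w. z \<in> S \<Longrightarrow> w \<in> S \<Longrightarrow> ?c (fst (z, w)) + ?c (snd (z, w)) \<le> ?c (fst (fst (z, w)), snd (snd (z, w))) + ?c (fst (snd (z, w)), snd (fst (z, w)))"
    using closed_full_measure_AE_pair[OF \<Gamma>p] by blast
  \<comment> \<open>A null set of the average is null for both couplings, so the same
    \<open>S\<close> carries each of them.\<close>
  have "- S \<in> sets borel" using S(1) by auto
  then have "emeasure \<Gamma>1 (- S) / 2 + emeasure \<Gamma>2 (- S) / 2 = 0"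
    using S(2) unfolding \<Gamma>_def by (simp add: emeasure_midpoint_measure[OF bp])
  then have S12: "emeasure \<Gamma>1 (- S) = 0" "emeasure \<Gamma>2 (- S) = 0"
    by (auto simp: ennreal_divide_eq_0_iff)
  have "{y. \<exists>x x'. x \<noteq> x' \<and> (x, y) \<in> S \<and> (x', y) \<in> S} \<in> null_sets lborel"
  proof (rule multivalued_fibres_null[OF p S(1)])
    show "norm (x - y) powr p + norm (x' - y') powr p \<le> norm (x - y') powr p + norm (x' - y) powr p"
      if "(x, y) \<in> S" "(x', y') \<in> S" for x y x' y'
      using mono[OF that] by simp
  qed
  then have "{y. \<exists>x x'. x \<noteq> x' \<and> (x, y) \<in> S \<and> (x', y) \<in> S} \<in> null_sets \<nu>"
    using \<nu>(2) by (auto simp: absolutely_continuous_def)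
  from couplings_first_marginal_eq[OF \<Gamma>1(1) \<Gamma>2(1) S(1) S12 this] show ?thesis .
qed

text \<open>The product measure is a coupling of finite cost, since the p-th power of a distance is
  at most \<open>2 powr p\<close> times the sum of the p-th powers of the norms.\<close>

lemma wasserstein_pow_finite:
  fixes \<mu> \<nu> :: "'b::euclidean_space measure"
  assumes p: "p > 0" and \<mu>: "\<mu> \<in> borel_probs_p p" and \<nu>: "\<nu> \<in> borel_probs_p p"
  shows "wasserstein_pow p \<mu> \<nu> < \<infinity>"
proof -
  have s[measurable_cong]: "sets \<mu> = sets borel" "sets \<nu> = sets borel"
    and pr: "prob_space \<mu>" "prob_space \<nu>"
    and mom: "p_moment p \<mu> < \<infinity>" "p_moment p \<nu> < \<infinity>"
    using \<mu> \<nu> by (auto simp: borel_probs_p_def borel_probs_def)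
  interpret \<mu>: prob_space \<mu> by fact
  interpret \<nu>: prob_space \<nu> by fact
  interpret P: pair_prob_space \<mu> \<nu> ..
  let ?P = "\<mu> \<Otimes>\<^sub>M \<nu>"
  have U: "space \<mu> = UNIV" "space \<nu> = UNIV" using s[THEN sets_eq_imp_space_eq] by simp_all
  have sP: "sets ?P = sets borel"
    using sets_pair_measure_cong[OF s] by (simp only: borel_prod)
  have P: "?P \<in> couplings \<mu> \<nu>"
  proof (rule couplingsI)
    show "?P \<in> borel_probs" using sP P.prob_space_axioms by (simp add: borel_probs_def)
    show "emeasure ?P (A \<times> UNIV) = emeasure \<mu> A" if "A \<in> sets borel" for A
      using \<nu>.emeasure_pair_measure_Times[of A \<mu> UNIV] that s U \<nu>.emeasure_space_1 by simp
    show "emeasure ?P (UNIV \<times> B) = emeasure \<nu> B" if "B \<in> sets borel" for B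
      using \<nu>.emeasure_pair_measure_Times[of UNIV \<mu> B] that s U \<mu>.emeasure_space_1 by simp
  qed (fact s)+
  have bound: "ennreal (norm (x - y) powr p) \<le> ennreal (2 powr p) * (ennreal (norm x powr p) + ennreal (norm y powr p))" for x y :: 'b
  proof -
    have "norm (x - y) \<le> 2 * max (norm x) (norm y)"
      using norm_triangle_ineq4[of x y] by linarith
    then have "norm (x - y) powr p \<le> (2 * max (norm x) (norm y)) powr p"
      using p by (intro powr_mono2) auto
    also have "\<dots> = 2 powr p * max (norm x) (norm y) powr p"
      by (intro powr_mult)
    also have "\<dots> \<le> 2 powr p * (norm x powr p + norm y powr p)"
      by (intro mult_left_mono) (auto simp: max_def)
    finally show ?thesis
      by (simp add: ennreal_mult'[symmetric] ennreal_plus[symmetric] ennreal_leI del: ennreal_plus)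
  qed
  have "wasserstein_pow p \<mu> \<nu> \<le> (\<integral>\<^sup>+ z. ennreal (norm (fst z - snd z) powr p) \<partial>?P)"
    unfolding wasserstein_pow_def using P by (rule INF_lower)
  also have "\<dots> \<le> (\<integral>\<^sup>+ z. ennreal (2 powr p) * (ennreal (norm (fst z) powr p) + ennreal (norm (snd z) powr p)) \<partial>?P)"
    by (intro nn_integral_mono bound)
  also have "\<dots> = ennreal (2 powr p) * ((\<integral>\<^sup>+ z. ennreal (norm (fst z) powr p) \<partial>?P) + (\<integral>\<^sup>+ z. ennreal (norm (snd z) powr p) \<partial>?P))"
    by (subst nn_integral_cmult, measurable) (subst nn_integral_add, measurable)
  also have "(\<integral>\<^sup>+ z. ennreal (norm (fst z) powr p) \<partial>?P) = p_moment p \<mu>"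
    by (subst \<nu>.nn_integral_fst[symmetric]) (auto simp: p_moment_def \<nu>.emeasure_space_1)
  also have "(\<integral>\<^sup>+ z. ennreal (norm (snd z) powr p) \<partial>?P) = p_moment p \<nu>"
    by (subst \<nu>.nn_integral_fst[symmetric]) (auto simp: p_moment_def \<mu>.emeasure_space_1)
  also have "ennreal (2 powr p) * (p_moment p \<mu> + p_moment p \<nu>) < \<infinity>"
    using mom by (auto simp: ennreal_mult_less_top)
  finally show ?thesis .
qed

section \<open>Uniqueness of minimizers, injectivity and feasibility\<close>

theorem theorem1p2:
  fixes \<nu> :: "'b::euclidean_space measure"
    and \<rho> :: "'a::polish_space \<Rightarrow> 'b measure"
    and p :: real
  assumes "p > 1"
    and "\<nu> \<in> borel_probs_p p"
    and "absolutely_continuous lborel \<nu>"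
    and "markov_kernel \<rho>"
    and nondegenerate: "\<And>x. (UNIV :: 'a set) = {x} \<Longrightarrow> \<rho> x \<in> borel_probs_p p"
  shows "(\<forall>\<sigma>1 \<in> minimizers p \<rho> \<nu>. \<forall>\<sigma>2 \<in> minimizers p \<rho> \<nu>. \<sigma>1 = \<sigma>2) \<longleftrightarrow>
         inj_on (mixture \<rho>) (minimizers p \<rho> \<nu>) \<and> min_value p \<rho> \<nu> < \<infinity>"
proof (intro iffI conjI)
  assume unique: "\<forall>\<sigma>1 \<in> minimizers p \<rho> \<nu>. \<forall>\<sigma>2 \<in> minimizers p \<rho> \<nu>. \<sigma>1 = \<sigma>2"
  then show "inj_on (mixture \<rho>) (minimizers p \<rho> \<nu>)" by (auto simp: inj_on_def)
  show "min_value p \<rho> \<nu> < \<infinity>"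
  proof (rule ccontr)
    assume "\<not> min_value p \<rho> \<nu> < \<infinity>"
    then have inf: "min_value p \<rho> \<nu> = \<infinity>" by (simp add: less_top[symmetric])
    \<comment> \<open>An infinite infimum is attained by every Borel probability measure.\<close>
    have min: "\<sigma> \<in> minimizers p \<rho> \<nu>" if "\<sigma> \<in> borel_probs" for \<sigma>
      using INF_lower[OF that, of "\<lambda>\<sigma>. wasserstein_pow p (mixture \<rho> \<sigma>) \<nu>"] inf that
      by (simp add: minimizers_def min_value_def top_unique)
    have ret: "return borel x \<in> borel_probs" for x :: 'a
      by (simp add: borel_probs_def prob_space_return)
    \<comment> \<open>All Dirac measures are minimizers, hence equal, and equal Dirac measures sit
      at the same point.\<close>
    have "x = y" for x y :: 'a
    proof -
      have "return borel x = return borel y" using unique min[OF ret] by blast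
      then have "emeasure (return borel x) {x} = emeasure (return borel y) {x}" by simp
      then show ?thesis by (simp add: indicator_def split: if_splits)
    qed
    then obtain x where x: "(UNIV :: 'a set) = {x}" by blast
    have "mixture \<rho> (return borel x) = \<rho> x"
      unfolding mixture_def using assms(4)
      by (intro bind_return[where N = borel]) (auto simp: markov_kernel_iff measurable_prob_algebraD)
    then have "wasserstein_pow p (\<rho> x) \<nu> = \<infinity>"
      using min[OF ret, of x] inf by (simp add: minimizers_def)
    then show False
      using wasserstein_pow_finite[OF _ nondegenerate[OF x] assms(2)] assms(1) by simp
  qed
next
  assume A: "inj_on (mixture \<rho>) (minimizers p \<rho> \<nu>) \<and> min_value p \<rho> \<nu> < \<infinity>"
  show "\<forall>\<sigma>1 \<in> minimizers p \<rho> \<nu>. \<forall>\<sigma>2 \<in> minimizers p \<rho> \<nu>. \<sigma>1 = \<sigma>2"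
  proof (intro ballI)
    fix \<sigma>1 \<sigma>2 assume m: "\<sigma>1 \<in> minimizers p \<rho> \<nu>" "\<sigma>2 \<in> minimizers p \<rho> \<nu>"
    then have bp: "\<sigma>1 \<in> borel_probs" "\<sigma>2 \<in> borel_probs"
      and W: "wasserstein_pow p (mixture \<rho> \<sigma>1) \<nu> = min_value p \<rho> \<nu>"
        "wasserstein_pow p (mixture \<rho> \<sigma>2) \<nu> = min_value p \<rho> \<nu>"
      by (auto simp: minimizers_def)
    \<comment> \<open>The midpoint competes in the infimum, and the average of two equal values is
      that value; this is the inequality that strict convexity turns into equality of the
      mixtures.\<close>
    have "min_value p \<rho> \<nu> \<le> wasserstein_pow p (mixture \<rho> (midpoint_measure \<sigma>1 \<sigma>2)) \<nu>"
      unfolding min_value_def by (rule INF_lower) (rule midpoint_measure_in_borel_probs[OF bp])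
    then have "mixture \<rho> \<sigma>1 = mixture \<rho> \<sigma>2"
      using assms A W bp
      by (intro wasserstein_pow_strict_convex[of p \<nu>])
        (auto simp: borel_probs_p_def mixture_in_borel_probs mixture_midpoint_measure ennreal_half_plus_half)
    then show "\<sigma>1 = \<sigma>2" using A m by (auto dest: inj_onD)
  qed
qed

end
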